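(* Let $q$ be an odd prime power and $r>2$, $n\ge1$ integers. If an $(n-1)$-spread $\mathcal{S}$ of $\mathrm{PG}(rn-1,q)$ contains at least $r+1$ normal elements such that some $r$ of these elements span the whole space $\mathrm{PG}(rn-1,q)$, then $\mathcal{S}$ is Desarguesian.
   Context: An $(n-1)$-spread of $\mathrm{PG}(N-1,q)$ is a set of $(n-1)$-dimensional subspaces partitioning the point set. An element $E$ of an $(n-1)$-spread $\mathcal{S}$ of $\mathrm{PG}(rn-1,q)$ is normal if for every $F\in\mathcal{S}\setminus\{E\}$ the $(2n-1)$-space $\langle E,F\rangle$ is partitioned by elements of $\mathcal{S}$. A Desarguesian spread of $\mathrm{PG}(rn-1,q)$ is (any spread projectively equivalent to) the spread obtained by field reduction: regard $\mathbb{F}_{q^n}^r$ as an $rn$-dimensional $\mathbb{F}_q$-vector space; its $1$-dimensional $\mathbb{F}_{q^n}$-subspaces become $(n-1)$-spaces of $\mathrm{PG}(rn-1,q)$, forming the spread. *)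

theory Defs
  imports "HOL-Analysis.Cartesian_Space" "HOL-Algebra.Algebraic_Closure_Type"
begin

text \<open>
  For a finite field \<open>'a\<close> of order \<open>q\<close> and a finite type \<open>'m\<close> with \<open>N\<close> elements, the projective
  space \<open>PG(N - 1, q)\<close> is the lattice of linear subspaces of \<open>'a ^ 'm\<close>, incidence being inclusion.
  All dimensions below are projective, i.e. one less than the linear dimension.
\<close>

definition pg_subspace :: "nat \<Rightarrow> ('a::field ^ 'm) set \<Rightarrow> bool" where
  "pg_subspace k U \<longleftrightarrow> vec.subspace U \<and> vec.dim U = k + 1"

definition pg_point :: "('a::field ^ 'm) set \<Rightarrow> bool" where
  "pg_point P \<longleftrightarrow> pg_subspace 0 P"

definition partitions_points :: "('a::field ^ 'm) set set \<Rightarrow> ('a ^ 'm) set \<Rightarrow> bool" where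
  "partitions_points T W \<longleftrightarrow>
     (\<forall>U\<in>T. U \<subseteq> W) \<and> (\<forall>P. pg_point P \<and> P \<subseteq> W \<longrightarrow> (\<exists>!U. U \<in> T \<and> P \<subseteq> U))"

definition pg_spread :: "nat \<Rightarrow> ('a::field ^ 'm) set set \<Rightarrow> bool" where
  "pg_spread k S \<longleftrightarrow> (\<forall>U\<in>S. pg_subspace k U) \<and> partitions_points S UNIV"

definition normal_element :: "('a::field ^ 'm) set set \<Rightarrow> ('a ^ 'm) set \<Rightarrow> bool" where
  "normal_element S E \<longleftrightarrow>
     E \<in> S \<and> (\<forall>F\<in>S - {E}. \<exists>T\<subseteq>S. partitions_points T (vec.span (E \<union> F)))"

text \<open>
  The space \<open>K\<^sup>r\<close> over a field \<open>K\<close>: coordinates are indexed by \<open>{..<r}\<close>, and functions are made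
  \<open>undefined\<close> outside this range.
\<close>

definition coord_space :: "('k, 'x) ring_scheme \<Rightarrow> nat \<Rightarrow> (nat \<Rightarrow> 'k) set" where
  "coord_space K r = {..<r} \<rightarrow>\<^sub>E carrier K"

definition coord_zero :: "('k, 'x) ring_scheme \<Rightarrow> nat \<Rightarrow> nat \<Rightarrow> 'k" where
  "coord_zero K r = (\<lambda>i\<in>{..<r}. \<zero>\<^bsub>K\<^esub>)"

definition coord_add ::
  "('k, 'x) ring_scheme \<Rightarrow> nat \<Rightarrow> (nat \<Rightarrow> 'k) \<Rightarrow> (nat \<Rightarrow> 'k) \<Rightarrow> nat \<Rightarrow> 'k" where
  "coord_add K r u v = (\<lambda>i\<in>{..<r}. u i \<oplus>\<^bsub>K\<^esub> v i)"

definition coord_smult ::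
  "('k, 'x) ring_scheme \<Rightarrow> nat \<Rightarrow> 'k \<Rightarrow> (nat \<Rightarrow> 'k) \<Rightarrow> nat \<Rightarrow> 'k" where
  "coord_smult K r c v = (\<lambda>i\<in>{..<r}. c \<otimes>\<^bsub>K\<^esub> v i)"

text \<open>The set of 1-dimensional \<open>K\<close>-subspaces of \<open>K\<^sup>r\<close>.\<close>

definition coord_lines :: "('k, 'x) ring_scheme \<Rightarrow> nat \<Rightarrow> (nat \<Rightarrow> 'k) set set" where
  "coord_lines K r =
     {{coord_smult K r c v | c. c \<in> carrier K} | v. v \<in> coord_space K r - {coord_zero K r}}"

text \<open>
  Here \<open>\<phi>\<close> embeds the field \<open>'a\<close> of order \<open>q\<close> into the field \<open>K\<close> of order \<open>q ^ n\<close>, so that \<open>K\<^sup>r\<close>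
  becomes a vector space over \<open>'a\<close>, and \<open>f\<close> is an \<open>'a\<close>-linear isomorphism from it onto \<open>'a ^ 'm\<close>
  (forcing \<open>CARD('m) = r * n\<close>).  Since \<open>f\<close> is an arbitrary linear isomorphism, all spreads
  projectively equivalent to a given field reduction spread are included; as \<open>\<phi>\<close> is arbitrary
  too (it may be composed with any automorphism of \<open>'a\<close>), this also covers equivalence under
  semilinear maps.  Taking the carrier of \<open>K\<close> inside \<open>nat\<close> is no restriction, since \<open>K\<close> is finite.
\<close>

definition desarguesian_spread ::
  "nat \<Rightarrow> nat \<Rightarrow> ('a::{field,finite} ^ 'm) set set \<Rightarrow> bool" where
  "desarguesian_spread r n S \<longleftrightarrow>
     (\<exists>(K :: nat ring) \<phi> f.
        field K \<and> card (carrier K) = CARD('a) ^ n \<and>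
        \<phi> \<in> ring_hom (ring_of_type_algebra :: 'a ring) K \<and>
        bij_betw f (coord_space K r) UNIV \<and>
        (\<forall>u\<in>coord_space K r. \<forall>v\<in>coord_space K r. f (coord_add K r u v) = f u + f v) \<and>
        (\<forall>c. \<forall>v\<in>coord_space K r. f (coord_smult K r (\<phi> c) v) = c *s f v) \<and>
        S = (\<lambda>L. f ` L) ` coord_lines K r)"

end

theory Submission
  imports Defs "HOL-Algebra.Group_Action" "HOL-Number_Theory.Residues"
begin

text \<open>
  The \<open>r\<close> spanning normal elements \<open>E 0, \<dots>, E (r - 1)\<close> decompose the space as a direct sum, and
  identifying all summands with one spread element \<open>F\<close> in general position turns the space into
  \<open>F\<^sup>r\<close>.  Normality makes the projections along the summands map spread elements to spread elements;
  the element through \<open>(e, w)\<close> in a two-dimensional coordinate plane, where \<open>e \<in> F\<close> is fixed, is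
  the graph of a map \<open>x \<mapsto> w * x\<close>.  Comparing three coordinates shows that \<open>*\<close> does not depend on the
  plane and is associative, so \<open>F\<close> is a nearfield, distributive on one side, and the spread elements
  are the sets \<open>{(c\<^sub>0 * x, \<dots>, c\<^sub>r\<^sub>-\<^sub>1 * x) | x \<in> F}\<close>.  A further normal element forces the other
  distributive law.  Hence \<open>F\<close> is a finite division ring, so a field by Wedderburn's theorem, which is
  proved by Witt's argument via the class equation, and the spread is that of the \<open>F\<close>-lines of \<open>F\<^sup>r\<close>.
\<close>

subsection \<open>Wedderburn's theorem\<close>

lemma norm_prod_mset_ge:
  fixes f :: "'a \<Rightarrow> complex" and b :: real
  assumes "\<And>x. x \<in># M \<Longrightarrow> norm (f x) \<ge> b" and "b \<ge> 1"
  shows "norm (\<Prod>x\<in>#M. f x) \<ge> (1::real)"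
  using assms(1)
proof (induction M)
  case (add x M)
  have "1 * 1 \<le> norm (f x) * norm (\<Prod>x\<in>#M. f x)"
    using add.IH add.prems assms(2) by (intro mult_mono) (fastforce intro: order_trans)+
  then show ?case by (simp add: norm_mult)
qed simp

text \<open>The point 1 is the only one on the unit circle at distance \<open>q - 1\<close> from
  \<open>q\<close>. The strict inequality for all others is what eventually contradicts the class
  equation.\<close>

lemma norm_of_nat_diff_root_of_unity:
  fixes z :: complex
  assumes "norm z = 1" and "q \<ge> 1"
  shows "norm (of_nat q - z) \<ge> real q - 1" and "z \<noteq> 1 \<Longrightarrow> norm (of_nat q - z) > real q - 1"
proof -
  have "norm (of_nat q :: complex) - norm z \<le> norm (of_nat q - z)" by (rule norm_triangle_ineq2)
  then show "norm (of_nat q - z) \<ge> real q - 1" using assms by simp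
  assume "z \<noteq> 1"
  have "Re z < 1"
  proof (rule ccontr)
    assume "\<not> Re z < 1"
    moreover have "Re z \<le> 1" using complex_Re_le_cmod[of z] assms by simp
    ultimately have "Re z = 1" by simp
    with assms have "Im z = 0" by (simp add: cmod_def)
    with \<open>Re z = 1\<close> \<open>z \<noteq> 1\<close> show False by (simp add: complex_eq_iff)
  qed
  then have "real q - 1 < Re (of_nat q - z)" by simp
  also have "\<dots> \<le> norm (of_nat q - z)" by (rule complex_Re_le_cmod)
  finally show "norm (of_nat q - z) > real q - 1" .
qed

text \<open>
  The witness is the value at \<open>q\<close> of \<open>(X\<^sup>n - 1) / lcm {X\<^sup>d - 1 | d dvd n, d < n}\<close>, which is the
  \<open>n\<close>-th cyclotomic polynomial up to sign; forming it in \<open>\<int>[X]\<close> makes integrality immediate.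
\<close>

lemma exists_cyclotomic_value:
  fixes n q :: nat
  assumes n: "n \<ge> 2" and q: "q \<ge> 2"
  shows "\<exists>c::int. \<bar>c\<bar> > int q - 1 \<and> c dvd int q ^ n - 1 \<and>
           (\<forall>d. d dvd n \<longrightarrow> d < n \<longrightarrow> (int q ^ d - 1) * c dvd int q ^ n - 1)"
proof -
  define P :: "nat \<Rightarrow> int poly" where "P d = monom 1 d - 1" for d
  define A where "A = {d. d dvd n \<and> d < n}"
  define L where "L = Lcm_fin (P ` A)"
  have finA: "finite A" unfolding A_def by simp
  have PL: "P d dvd L" if "d \<in> A" for d
    unfolding L_def using that finA by (intro dvd_Lcm_fin) auto
  have PP: "P d dvd P n" if "d \<in> A" for d
  proof -
    obtain k where k: "n = d * k" using \<open>d \<in> A\<close> by (auto simp: A_def)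
    have "monom (1::int) n = monom 1 d ^ k" by (simp add: k monom_power)
    moreover have "monom (1::int) d - 1 dvd monom 1 d ^ k - 1"
      by (simp add: power_diff_1_eq)
    ultimately show ?thesis by (simp add: P_def)
  qed
  have "L dvd P n"
    unfolding L_def using PP by (intro Lcm_fin_least) (auto simp: finA)
  then obtain \<Phi> where \<Phi>: "P n = L * \<Phi>" by (elim dvdE)
  have polyP: "poly (P d) (int q) = int q ^ d - 1" for d by (simp add: P_def poly_monom)
  \<comment> \<open>Passing to complex coefficients makes the roots of \<Phi> available.\<close>
  define h :: "int poly \<Rightarrow> complex poly" where "h = map_poly of_int"
  have h_mult: "h (a * b) = h a * h b" for a b
    unfolding h_def by (intro poly_eqI) (simp add: coeff_map_poly coeff_mult)
  have h_one: "h 1 = 1" by (simp add: h_def)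
  have h_prod: "h (\<Prod>x\<in>B. g x) = (\<Prod>x\<in>B. h (g x))" for B :: "nat set" and g
    by (induction B rule: infinite_finite_induct) (simp_all add: h_mult h_one)
  have hP: "h (P d) = monom 1 d - 1" for d
    unfolding h_def P_def by (intro poly_eqI) (simp add: coeff_map_poly coeff_1)
  have h_of_int: "poly (h p) (of_nat q) = of_int (poly p (int q))" for p
    by (induction p) (simp_all add: h_def map_poly_pCons)
  have P0: "P n \<noteq> 0"
  proof
    assume "P n = 0"
    then have "poly (P n) (int q) = 0" by simp
    then have "int q ^ n = 1" using polyP by simp
    then show False using q n one_less_power[of "int q" n] by simp
  qed
  then have \<Phi>0: "\<Phi> \<noteq> 0" using \<Phi> by auto
  have roots: "norm z = 1" if "poly (h \<Phi>) z = 0" for z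
  proof -
    have "poly (h (P n)) z = 0" using that by (simp add: \<Phi> h_mult)
    then have "z ^ n = 1" by (simp add: hP poly_monom)
    then have "norm z ^ n = 1" by (metis norm_one norm_power)
    then show ?thesis using n power_eq_imp_eq_base[of "norm z" n 1] by simp
  qed
  define \<zeta> where "\<zeta> = cis (2 * pi / n)"
  have \<zeta>: "\<zeta> ^ d = cis (2 * pi * d / n)" for d
    by (simp add: \<zeta>_def DeMoivre mult_ac)
  have \<zeta>_neq: "\<zeta> ^ d \<noteq> 1" if "d < n" "d > 0" for d
  proof
    assume "\<zeta> ^ d = 1"
    moreover have "inj_on (\<lambda>k. cis (2 * pi * real k / real n)) {..<n}"
      using bij_betw_roots_unity[of n] n by (simp add: bij_betw_def)
    ultimately have "d = 0"
      using \<zeta>[of d] \<open>d < n\<close> by (auto dest!: inj_onD[where x = d and y = 0])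
    then show False using that by simp
  qed
  have "poly (h \<Phi>) \<zeta> = 0"
  proof -
    have "poly (h (P n)) \<zeta> = 0" using n by (simp add: hP poly_monom \<zeta>)
    \<comment> \<open>The primitive root \<zeta> is a root of no \<open>P d\<close> with
      \<open>d \<in> A\<close>, hence not of their product, which \<open>L\<close> divides.\<close>
    moreover have "poly (h L) \<zeta> \<noteq> 0"
    proof
      assume L0: "poly (h L) \<zeta> = 0"
      have "L dvd (\<Prod>d\<in>A. P d)"
        unfolding L_def using finA by (intro Lcm_fin_least) (auto intro: dvd_prodI)
      then have "poly (h (\<Prod>d\<in>A. P d)) \<zeta> = 0" using L0 by (auto simp: h_mult elim!: dvdE)
      then have "\<exists>d\<in>A. poly (h (P d)) \<zeta> = 0" using finA by (simp add: h_prod poly_prod)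
      then obtain d where "d \<in> A" "\<zeta> ^ d = 1" by (auto simp: hP poly_monom)
      then show False using \<zeta>_neq[of d] n by (auto simp: A_def dest: dvd_pos_nat intro: Nat.gr0I)
    qed
    ultimately show ?thesis by (simp add: \<Phi> h_mult)
  qed
  define c where "c = poly \<Phi> (int q)"
  have h\<Phi>0: "h \<Phi> \<noteq> 0" using \<Phi>0 by (simp add: h_def map_poly_eq_0_iff)
  obtain M where M: "h \<Phi> = smult (lead_coeff (h \<Phi>)) (\<Prod>x\<in>#M. [:-x, 1:])"
    using alg_closed_imp_factorization[OF h\<Phi>0] by blast
  have Mroot: "poly (h \<Phi>) x = 0 \<longleftrightarrow> x \<in># M" for x
    using h\<Phi>0 by (subst M) (auto simp: poly_prod_mset prod_mset_zero_iff)
  obtain N where N: "M = add_mset \<zeta> N"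
    using Mroot \<open>poly (h \<Phi>) \<zeta> = 0\<close> by (metis insert_DiffM)
  have "lead_coeff (h \<Phi>) = of_int (lead_coeff \<Phi>)"
    unfolding h_def using \<Phi>0 by (intro lead_coeff_map_poly_nz) auto
  \<comment> \<open>A nonzero integer has absolute value at least 1, so the bound holds whatever the
    leading coefficient is.\<close>
  then have lc: "norm (lead_coeff (h \<Phi>)) \<ge> 1"
    using \<Phi>0 by (simp add: norm_of_int) (metis leading_coeff_0_iff of_int_1_le_iff of_int_abs zero_less_abs_iff int_one_le_iff_zero_less)
  have "norm (of_int c :: complex) = norm (poly (h \<Phi>) (of_nat q))"
    by (simp add: c_def h_of_int)
  also have "\<dots> = norm (lead_coeff (h \<Phi>)) * (norm (of_nat q - \<zeta>) * norm (\<Prod>x\<in>#N. of_nat q - x))"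
  proof (subst M)
    have "poly (\<Prod>x\<in>#M. [:-x, 1:]) (of_nat q) = (of_nat q - \<zeta>) * (\<Prod>x\<in>#N. of_nat q - x)"
      by (simp add: N poly_prod_mset algebra_simps)
    then show "norm (poly (smult (lead_coeff (h \<Phi>)) (\<Prod>x\<in>#M. [:-x, 1:])) (of_nat q)) =
      norm (lead_coeff (h \<Phi>)) * (norm (of_nat q - \<zeta>) * norm (\<Prod>x\<in>#N. of_nat q - x))"
      by (simp only: poly_smult norm_mult)
  qed
  \<comment> \<open>One strict factor suffices: \<zeta> contributes more than \<open>q - 1\<close>,
    and every other root at least \<open>q - 1\<close>, which is at least 1.\<close>
  also have "\<dots> \<ge> 1 * (norm (of_nat q - \<zeta>) * 1)"
  proof (intro mult_mono lc order_refl)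
    show "1 \<le> norm (\<Prod>x\<in>#N. of_nat q - x)"
    proof (rule norm_prod_mset_ge[where b = "real q - 1"])
      fix x assume "x \<in># N"
      then have "norm x = 1" using Mroot[of x] N roots by simp
      then show "real q - 1 \<le> norm (of_nat q - x)"
        using norm_of_nat_diff_root_of_unity(1) q by simp
    qed (use q in simp)
  qed auto
  moreover have "norm (of_nat q - \<zeta>) > real q - 1"
    using \<zeta>_neq[of 1] n q by (intro norm_of_nat_diff_root_of_unity) (auto simp: \<zeta>_def)
  ultimately have "real_of_int \<bar>c\<bar> > real_of_int (int q - 1)" by (simp add: norm_of_int)
  then have "\<bar>c\<bar> > int q - 1" by (simp only: of_int_less_iff)
  moreover have "int q ^ n - 1 = poly L (int q) * c"
    using arg_cong[OF \<Phi>, of "\<lambda>p. poly p (int q)"] by (simp add: polyP c_def)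
  moreover have "(int q ^ d - 1) * c dvd poly L (int q) * c" if "d dvd n" "d < n" for d
  proof (rule mult_dvd_mono)
    show "int q ^ d - 1 dvd poly L (int q)"
      using PL[of d] that by (auto simp: A_def polyP[symmetric] elim!: dvdE)
  qed auto
  ultimately show ?thesis by (intro exI[of _ c]) auto
qed

text \<open>Euclid's algorithm on exponents: for \<open>n = d + k\<close>, the number
  \<open>q ^ d - 1\<close> also divides \<open>q ^ k - 1\<close>. Once the exponent is below
  \<open>d\<close>, the dividend is smaller than the divisor and must vanish.\<close>

lemma power_minus_one_dvdD:
  fixes q :: nat
  assumes "q \<ge> 2" and "int q ^ d - 1 dvd int q ^ n - 1" and "d > 0"
  shows "d dvd n"
  using assms(2)
proof (induction n rule: less_induct)
  case (less n)
  have gt: "int q ^ d > 1" using assms by (simp add: one_less_power)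
  show ?case
  proof (cases "n < d")
    case True
    then have "int q ^ n - 1 < int q ^ d - 1" using assms by (simp add: power_strict_increasing)
    moreover have "int q ^ n - 1 \<ge> 0" using assms by simp
    ultimately have "int q ^ n - 1 = 0" using zdvd_not_zless[of "int q ^ n - 1" "int q ^ d - 1"] less.prems by linarith
    then have "n = 0" using assms one_less_power[of "int q" n] by (cases "n = 0") auto
    then show ?thesis by simp
  next
    case False
    then obtain k where k: "n = d + k" by (metis le_add_diff_inverse not_less)
    have "int q ^ n - 1 = int q ^ k * (int q ^ d - 1) + (int q ^ k - 1)"
      by (simp add: k power_add algebra_simps)
    then have "int q ^ d - 1 dvd int q ^ k - 1"
      using less.prems by (metis dvd_add_right_iff dvd_triv_right)
    then show ?thesis using less.IH[of k] assms(3) k by simp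
  qed
qed

section \<open>The center and subspaces over it\<close>

context ring
begin

definition center :: "'a set" where
  "center = {z \<in> carrier R. \<forall>x\<in>carrier R. z \<otimes> x = x \<otimes> z}"

definition centralizer :: "'a \<Rightarrow> 'a set" where
  "centralizer a = {x \<in> carrier R. x \<otimes> a = a \<otimes> x}"

text \<open>Vector subspaces over the center, phrased inside the ring so that no separate vector
  space has to be built. Negatives come from the central scalar -1.\<close>

definition center_subspace :: "'a set \<Rightarrow> bool" where
  "center_subspace W \<longleftrightarrow> W \<subseteq> carrier R \<and> \<zero> \<in> W \<and>
     (\<forall>u\<in>W. \<forall>v\<in>W. u \<oplus> v \<in> W) \<and> (\<forall>z\<in>center. \<forall>u\<in>W. z \<otimes> u \<in> W)"

lemma center_carrier [simp]: "z \<in> center \<Longrightarrow> z \<in> carrier R"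
  unfolding center_def by blast

lemma center_commute: "z \<in> center \<Longrightarrow> x \<in> carrier R \<Longrightarrow> z \<otimes> x = x \<otimes> z"
  unfolding center_def by blast

lemma centerI:
  "z \<in> carrier R \<Longrightarrow> (\<And>x. x \<in> carrier R \<Longrightarrow> z \<otimes> x = x \<otimes> z) \<Longrightarrow> z \<in> center"
  unfolding center_def by blast

lemma center_minus: 
  assumes "z \<in> center" "w \<in> center" shows "z \<ominus> w \<in> center"
proof (rule centerI)
  show "z \<ominus> w \<in> carrier R" using assms by simp
  fix x assume x: "x \<in> carrier R"
  then have "(z \<ominus> w) \<otimes> x = z \<otimes> x \<ominus> w \<otimes> x"
    using assms by (simp add: a_minus_def l_distr l_minus)
  also have "\<dots> = x \<otimes> z \<ominus> x \<otimes> w"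
    using assms x center_commute by metis
  also have "\<dots> = x \<otimes> (z \<ominus> w)"
    using assms x by (simp add: a_minus_def r_distr r_minus)
  finally show "(z \<ominus> w) \<otimes> x = x \<otimes> (z \<ominus> w)" .
qed

lemma zero_center [simp]: "\<zero> \<in> center" and one_center [simp]: "\<one> \<in> center"
  by (auto intro: centerI)

lemma center_add:
  assumes "z \<in> center" "w \<in> center" shows "z \<oplus> w \<in> center"
proof (rule centerI)
  fix x assume x: "x \<in> carrier R"
  then show "(z \<oplus> w) \<otimes> x = x \<otimes> (z \<oplus> w)"
    using assms center_commute[of z x] center_commute[of w x]
    by (metis center_carrier l_distr r_distr)
qed (use assms in simp)

lemma center_mult:
  assumes "z \<in> center" "w \<in> center" shows "z \<otimes> w \<in> center"
proof (rule centerI)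
  fix x assume x: "x \<in> carrier R"
  then show "(z \<otimes> w) \<otimes> x = x \<otimes> (z \<otimes> w)"
    using assms center_commute[of z x] center_commute[of w x]
    by (metis center_carrier m_assoc)
qed (use assms in simp)

lemma minus_one_center: "\<ominus> \<one> \<in> center"
  using center_minus[of \<zero> \<one>] by (simp add: a_minus_def)

lemma center_inv:
  assumes "z \<in> center" "z \<in> Units R" shows "inv z \<in> center"
proof -
  have "inv z \<otimes> x = x \<otimes> inv z" if x: "x \<in> carrier R" for x
  proof -
    have "inv z \<otimes> x = inv z \<otimes> (x \<otimes> z) \<otimes> inv z"
      using assms x by (simp add: m_assoc)
    also have "\<dots> = inv z \<otimes> (z \<otimes> x) \<otimes> inv z"
      using assms x center_commute by metis
    also have "\<dots> = x \<otimes> inv z"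
      using assms x by (simp flip: m_assoc)
    finally show ?thesis .
  qed
  then show ?thesis using assms by (intro centerI) auto
qed

lemma center_subspace_carrier: "center_subspace (carrier R)"
  by (simp add: center_subspace_def)

lemma center_subspace_centralizer: 
  assumes "a \<in> carrier R" shows "center_subspace (centralizer a)"
proof -
  have "z \<otimes> x \<otimes> a = a \<otimes> (z \<otimes> x)" if "z \<in> center" "x \<in> carrier R" "x \<otimes> a = a \<otimes> x" for z x
    using that assms center_commute[of z] by (metis center_carrier m_assoc)
  then show ?thesis
    using assms by (auto simp: center_subspace_def centralizer_def l_distr r_distr)
qed

lemma center_subspace_minus:
  assumes "center_subspace W" "u \<in> W" "v \<in> W" shows "u \<ominus> v \<in> W"
proof -
  have "\<ominus> v = \<ominus> \<one> \<otimes> v" using assms by (auto simp: center_subspace_def l_minus)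
  then show ?thesis
    using assms minus_one_center unfolding center_subspace_def a_minus_def by metis
qed

text \<open>If \<open>z \<otimes> u \<oplus> w\<close> has a second representation, then
  \<open>(z \<ominus> z') \<otimes> u\<close> lies in \<open>W\<close>, and for
  \<open>z \<noteq> z'\<close> the central inverse of \<open>z \<ominus> z'\<close> would carry
  \<open>u\<close> into \<open>W\<close>. So adjoining one vector multiplies the size by that of the
  center.\<close>

lemma card_center_subspace_extend:
  assumes units: "Units R = carrier R - {\<zero>}"
    and W: "center_subspace W" and u: "u \<in> carrier R - W"
  defines "W' \<equiv> (\<lambda>(z, w). z \<otimes> u \<oplus> w) ` (center \<times> W)"
  shows "center_subspace W'" "W \<subseteq> W'" "u \<in> W'" "card W' = card center * card W"
proof -
  have Wc: "w \<in> carrier R" if "w \<in> W" for w using W that by (auto simp: center_subspace_def)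
  have uc: "u \<in> carrier R" using u by simp
  have W0: "\<zero> \<in> W" using W by (simp add: center_subspace_def)
  show "u \<in> W'"
    unfolding W'_def by (rule image_eqI[of _ _ "(\<one>, \<zero>)"]) (use uc W0 in auto)
  show "W \<subseteq> W'"
    unfolding W'_def by (rule subsetI, rule_tac image_eqI[of _ _ "(\<zero>, _)"]) (use uc Wc in auto)
  note zz = center_mult center_add
  show "center_subspace W'"
    unfolding center_subspace_def
  proof (intro conjI ballI)
    show "W' \<subseteq> carrier R" unfolding W'_def using uc Wc by auto
    show "\<zero> \<in> W'" using \<open>W \<subseteq> W'\<close> W0 by auto
  next
    fix x y assume "x \<in> W'" "y \<in> W'"
    then obtain z w z' w' where *: "x = z \<otimes> u \<oplus> w" "y = z' \<otimes> u \<oplus> w'"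
      "z \<in> center" "w \<in> W" "z' \<in> center" "w' \<in> W" unfolding W'_def by auto
    then have "x \<oplus> y = (z \<oplus> z') \<otimes> u \<oplus> (w \<oplus> w')"
      using uc Wc by (simp add: l_distr a_ac)
    then show "x \<oplus> y \<in> W'"
      unfolding W'_def using * zz W 
      by (intro image_eqI[of _ _ "(z \<oplus> z', w \<oplus> w')"]) (auto simp: center_subspace_def)
  next
    fix y x assume "y \<in> center" "x \<in> W'"
    then obtain z w where *: "x = z \<otimes> u \<oplus> w" "z \<in> center" "w \<in> W" unfolding W'_def by auto
    then have "y \<otimes> x = (y \<otimes> z) \<otimes> u \<oplus> y \<otimes> w"
      using uc Wc \<open>y \<in> center\<close> by (simp add: r_distr m_assoc)
    then show "y \<otimes> x \<in> W'"
      unfolding W'_def using * zz W \<open>y \<in> center\<close>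
      by (intro image_eqI[of _ _ "(y \<otimes> z, y \<otimes> w)"]) (auto simp: center_subspace_def)
  qed
  have "inj_on (\<lambda>(z, w). z \<otimes> u \<oplus> w) (center \<times> W)"
  proof (rule inj_onI, clarsimp)
    fix z w z' w'
    assume *: "z \<in> center" "w \<in> W" "z' \<in> center" "w' \<in> W" "z \<otimes> u \<oplus> w = z' \<otimes> u \<oplus> w'"
    have c: "z \<in> carrier R" "z' \<in> carrier R" "w \<in> carrier R" "w' \<in> carrier R" 
      using * Wc by auto
    have "z \<otimes> u \<oplus> w \<ominus> z' \<otimes> u \<ominus> w = z' \<otimes> u \<oplus> w' \<ominus> z' \<otimes> u \<ominus> w" using * by simp
    moreover have "z \<otimes> u \<oplus> w \<ominus> z' \<otimes> u \<ominus> w = (z \<ominus> z') \<otimes> u" using c uc by algebra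
    moreover have "z' \<otimes> u \<oplus> w' \<ominus> z' \<otimes> u \<ominus> w = w' \<ominus> w" using c uc by algebra
    ultimately have eq: "(z \<ominus> z') \<otimes> u = w' \<ominus> w" by simp
    then have inW: "(z \<ominus> z') \<otimes> u \<in> W" using center_subspace_minus[OF W] * by simp
    have "z \<ominus> z' = \<zero>"
    proof (rule ccontr)
      assume "z \<ominus> z' \<noteq> \<zero>"
      then have U: "z \<ominus> z' \<in> Units R" using units c by simp
      have "inv (z \<ominus> z') \<in> center" using center_inv[OF center_minus U] * by simp
      then have "inv (z \<ominus> z') \<otimes> ((z \<ominus> z') \<otimes> u) \<in> W"
        using inW W by (auto simp: center_subspace_def)
      then have "u \<in> W" using U uc c by (simp flip: m_assoc)
      then show False using u by simp
    qed
    then have "z = z'" using c by (simp add: r_right_minus_eq)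
    then show "z = z' \<and> w = w'" using * c uc by simp
  qed
  then show "card W' = card center * card W"
    unfolding W'_def by (simp add: card_image card_cartesian_product)
qed

text \<open>The exponent is the dimension over the center. In place of a basis, the proof takes a
  maximal subspace of \<open>U\<close> among those whose size is a power; it is all of
  \<open>U\<close>, as otherwise one more vector could be adjoined.\<close>

lemma card_center_subspace:
  assumes fin: "finite (carrier R)" and units: "Units R = carrier R - {\<zero>}"
    and U: "center_subspace U"
  shows "\<exists>d. card U = card center ^ d"
proof -
  define \<W> where "\<W> = {W. center_subspace W \<and> W \<subseteq> U \<and> (\<exists>d. card W = card center ^ d)}"
  have finU: "finite U" using U fin by (auto simp: center_subspace_def intro: finite_subset)
  have "{\<zero>} \<in> \<W>"
    using U by (auto simp: \<W>_def center_subspace_def intro: exI[of _ 0])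
  moreover have "finite \<W>" using finU by (auto simp: \<W>_def intro: finite_subset[of _ "Pow U"])
  ultimately obtain W where W: "W \<in> \<W>" and max: "\<And>W'. W' \<in> \<W> \<Longrightarrow> W \<subseteq> W' \<Longrightarrow> W' = W"
    using finite_has_maximal2[of \<W> "{\<zero>}"] by metis
  have "W = U"
  proof (rule ccontr)
    assume "W \<noteq> U"
    then obtain u where u: "u \<in> U" "u \<notin> W" using W by (auto simp: \<W>_def)
    then have u': "u \<in> carrier R - W" using U by (auto simp: center_subspace_def)
    have Ws: "center_subspace W" using W by (simp add: \<W>_def)
    note ext = card_center_subspace_extend[OF units Ws u']
    define W' where "W' = (\<lambda>(z, w). z \<otimes> u \<oplus> w) ` (center \<times> W)"
    obtain d where d: "card W = card center ^ d" using W by (auto simp: \<W>_def)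
    have "card W' = card center ^ Suc d" using ext(4) d by (simp add: W'_def)
    moreover have "W' \<subseteq> U"
      using U u W unfolding W'_def by (auto simp: \<W>_def center_subspace_def)
    moreover have "center_subspace W'" using ext(1) by (simp add: W'_def)
    ultimately have "W' \<in> \<W>" unfolding \<W>_def by blast
    then have "W' = W" using max ext(2) by (simp add: W'_def)
    then show False using ext(3) u by (simp add: W'_def)
  qed
  then show ?thesis using W by (simp add: \<W>_def)
qed

end

section \<open>The class equation\<close>

theorem (in ring) wedderburn:
  assumes fin: "finite (carrier R)" and units: "Units R = carrier R - {\<zero>}"
  shows "field R"
proof -
  define G where "G = units_of R"
  \<comment> \<open>The unit group acts on itself by conjugation: orbits are conjugacy classes, and
    stabilizers are centralizers with zero removed.\<close>
  define \<phi> where "\<phi> = (\<lambda>g. \<lambda>h\<in>carrier G. g \<otimes>\<^bsub>G\<^esub> h \<otimes>\<^bsub>G\<^esub> inv\<^bsub>G\<^esub> g)"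
  interpret G: group G unfolding G_def by (rule units_group)
  interpret act: group_action G "carrier G" \<phi>
    unfolding \<phi>_def by (rule G.action_by_conjugation)
  have Gc: "carrier G = carrier R - {\<zero>}" by (simp add: G_def units_of_carrier units)
  have Gm: "x \<otimes>\<^bsub>G\<^esub> y = x \<otimes> y" for x y by (simp add: G_def units_of_mult)
  have Gi: "inv\<^bsub>G\<^esub> x = inv x" if "x \<in> carrier G" for x
    using that by (simp add: G_def units_of_carrier units_of_inv)
  have U: "x \<in> Units R" "x \<in> carrier R" if "x \<in> carrier G" for x
    using that by (auto simp: G_def units_of_carrier)
  have one: "\<one> \<noteq> \<zero>" using Units_one_closed units by blast
  define q where "q = card center"
  have finZ: "finite center" using fin by (rule finite_subset[rotated]) auto
  have "card {\<zero>, \<one>} \<le> q" unfolding q_def by (rule card_mono[OF finZ]) simp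
  then have q2: "q \<ge> 2" using one by simp
  have cent_card: "\<exists>d. card W = q ^ d" if "center_subspace W" for W
    unfolding q_def by (rule card_center_subspace[OF fin units that])
  obtain n where n: "card (carrier R) = q ^ n"
    using cent_card center_subspace_carrier by blast
  have "card {\<zero>, \<one>} \<le> card (carrier R)" by (rule card_mono[OF fin]) simp
  then have n0: "n > 0" using one n by (cases n) auto
  have orderG: "Coset.order G = q ^ n - 1"
    unfolding Coset.order_def Gc using fin n by (simp add: card_Diff_subset)
  have act_eq: "\<phi> g h = g \<otimes> h \<otimes> inv g" if "g \<in> carrier G" "h \<in> carrier G" for g h
    using that by (simp add: \<phi>_def Gm Gi)
  have fixed_iff: "\<phi> g h = h \<longleftrightarrow> g \<otimes> h = h \<otimes> g" if "g \<in> carrier G" "h \<in> carrier G" for g h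
  proof
    assume "\<phi> g h = h"
    then have "g \<otimes> h \<otimes> inv g \<otimes> g = h \<otimes> g" using act_eq that by simp
    then show "g \<otimes> h = h \<otimes> g" using U that by (simp add: m_assoc)
  next
    assume "g \<otimes> h = h \<otimes> g"
    then have "\<phi> g h = h \<otimes> g \<otimes> inv g" using act_eq that by simp
    also have "\<dots> = h" using that U by (simp add: m_assoc)
    finally show "\<phi> g h = h" .
  qed
  have stab: "stabilizer G \<phi> a = centralizer a - {\<zero>}" if "a \<in> carrier G" for a
    using fixed_iff that by (auto simp: stabilizer_def centralizer_def Gc)
  have "n = 1"
  proof (rule ccontr)
    assume "n \<noteq> 1"
    with n0 have n2: "n \<ge> 2" by simp
    obtain c :: int where c: "\<bar>c\<bar> > int q - 1" "c dvd int q ^ n - 1"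
      "\<And>d. d dvd n \<Longrightarrow> d < n \<Longrightarrow> (int q ^ d - 1) * c dvd int q ^ n - 1"
      using exists_cyclotomic_value[OF n2 q2] by blast
    \<comment> \<open>A centralizer has \<open>q ^ d\<close> elements, so the class of
      \<open>a\<close> has \<open>(q ^ n - 1) / (q ^ d - 1)\<close>. For noncentral \<open>a\<close>
      the exponent \<open>d\<close> is a proper divisor of \<open>n\<close>, and the choice of
      \<open>c\<close> makes this quotient a multiple of \<open>c\<close>.\<close>
    have orb: "c dvd int (card (orbit G \<phi> a))" if a: "a \<in> carrier R - center" for a
    proof -
      have aG: "a \<in> carrier G" using a zero_center by (auto simp: Gc simp del: zero_center)
      have ac: "a \<in> carrier R" using a by simp
      obtain d where d: "card (centralizer a) = q ^ d"
        using cent_card center_subspace_centralizer[OF ac] by blast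
      have finC: "finite (centralizer a)" using fin by (simp add: centralizer_def)
      have "{\<zero>, \<one>} \<subseteq> centralizer a" using ac by (simp add: centralizer_def)
      then have "card {\<zero>, \<one>} \<le> q ^ d" using card_mono[OF finC] d by metis
      then have d0: "d > 0" using one by (cases d) auto
      have "card (stabilizer G \<phi> a) = q ^ d - 1"
        using stab[OF aG] d finC ac by (simp add: centralizer_def card_Diff_subset)
      then have "card (orbit G \<phi> a) * (q ^ d - 1) = q ^ n - 1"
        using act.orbit_stabilizer_theorem[OF aG] orderG by simp
      then have "int (card (orbit G \<phi> a) * (q ^ d - 1)) = int (q ^ n - 1)" by simp
      then have eq: "int q ^ n - 1 = (int q ^ d - 1) * int (card (orbit G \<phi> a))"
        using q2 by (simp add: of_nat_diff mult.commute)
      then have "int q ^ d - 1 dvd int q ^ n - 1" by simp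
      then have dn: "d dvd n" using power_minus_one_dvdD q2 d0 by blast
      have "d \<noteq> n"
      proof
        assume "d = n"
        then have "centralizer a = carrier R"
          using d n fin by (intro card_subset_eq) (auto simp: centralizer_def)
        then have "a \<in> center" using ac unfolding centralizer_def by (intro centerI) force+
        then show False using a by simp
      qed
      then have "d < n" using dn n0 by (simp add: dvd_imp_le le_neq_implies_less)
      then have "(int q ^ d - 1) * c dvd (int q ^ d - 1) * int (card (orbit G \<phi> a))"
        using c(3)[OF dn] eq by simp
      moreover have "int q ^ d > 1" using q2 d0 by (intro one_less_power) auto
      ultimately show ?thesis by simp
    qed
    define N where "N = carrier R - center"
    have NG: "N \<subseteq> carrier G" using zero_center by (auto simp: N_def Gc simp del: zero_center)
    have orbG: "orbit G \<phi> a \<subseteq> carrier G" if "a \<in> carrier G" for a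
      unfolding orbit_def using act.element_image[OF _ that] by blast
    have orbN: "orbit G \<phi> a \<subseteq> N" if "a \<in> N" for a
    proof
      fix b assume b: "b \<in> orbit G \<phi> a"
      have ab: "a \<in> carrier G" "b \<in> carrier G" using that NG orbG b by auto
      then have "a \<in> orbit G \<phi> b" using act.orbit_sym b by blast
      then obtain g where g: "g \<in> carrier G" "a = \<phi> g b" by (auto simp: orbit_def)
      have "b \<notin> center"
      proof
        assume "b \<in> center"
        then have "\<phi> g b = b" using fixed_iff g ab center_commute[of b g] U by metis
        then show False using g that \<open>b \<in> center\<close> by (simp add: N_def)
      qed
      then show "b \<in> N" using ab by (simp add: N_def Gc)
    qed
    have orbU: "\<Union> (orbit G \<phi> ` N) = N"
    proof (rule equalityI)
      show "\<Union> (orbit G \<phi> ` N) \<subseteq> N" using orbN by (rule UN_least)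
      show "N \<subseteq> \<Union> (orbit G \<phi> ` N)" using act.orbit_refl NG by blast
    qed
    have "nat \<bar>c\<bar> dvd card (\<Union> (orbit G \<phi> ` N))"
    proof (rule dvd_partition)
      have "finite N" using fin by (simp add: N_def)
      then show "finite (\<Union> (orbit G \<phi> ` N))" by (simp only: orbU)
      show "\<forall>B\<in>orbit G \<phi> ` N. nat \<bar>c\<bar> dvd card B" using orb by (auto simp: N_def nat_abs_dvd_iff)
      show "\<forall>A\<in>orbit G \<phi> ` N. \<forall>B\<in>orbit G \<phi> ` N. A \<noteq> B \<longrightarrow> A \<inter> B = {}"
      proof (intro ballI impI)
        fix A B assume A: "A \<in> orbit G \<phi> ` N" and B: "B \<in> orbit G \<phi> ` N" and "A \<noteq> B"
        have "x \<notin> B" if "x \<in> A" for x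
        proof
          assume "x \<in> B"
          have "A \<in> orbits G (carrier G) \<phi>" "B \<in> orbits G (carrier G) \<phi>"
            using A B NG unfolding orbits_def by blast+
          moreover have "x \<in> carrier G" using A that orbN NG by blast
          ultimately show False
            using partition.unique_class[OF act.orbit_partition] that \<open>x \<in> B\<close> \<open>A \<noteq> B\<close> by blast
        qed
        then show "A \<inter> B = {}" by blast
      qed
    qed
    then have "nat \<bar>c\<bar> dvd card N" by (simp only: orbU)
    moreover have "card N = q ^ n - q"
      unfolding N_def using n fin finZ by (subst card_Diff_subset) (auto simp: q_def)
    moreover have "q ^ n \<ge> q" using n0 q2 by (simp add: self_le_power)
    ultimately have "c dvd int q ^ n - int q" by (simp add: nat_abs_dvd_iff of_nat_diff)
    \<comment> \<open>The noncentral classes together give \<open>q ^ n - q\<close>. Subtracting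
      this from \<open>q ^ n - 1\<close> leaves \<open>q - 1\<close>, which is positive and smaller
      than the absolute value of \<open>c\<close>.\<close>
    then have "c dvd (int q ^ n - 1) - (int q ^ n - int q)" using c(2) by (rule dvd_diff[rotated])
    then have "c dvd int q - 1" by simp
    then have "\<bar>c\<bar> \<le> int q - 1" using q2 by (intro zdvd_imp_le) auto
    then show False using c(1) by simp
  qed
  then have "center = carrier R"
    using n fin by (intro card_subset_eq) (auto simp: q_def)
  then have "cring R"
    using center_commute by unfold_locales blast
  then show ?thesis using units by (rule cring.cring_fieldI)
qed

subsection \<open>Spreads with a spanning family of normal elements\<close>

lemma card_span_independent:
  fixes B :: "('a::{field,finite} ^ 'm::finite) set"
  assumes "vec.independent B"
  shows "card (vec.span B) = CARD('a) ^ card B"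
proof -
  have "finite B" by simp
  then show ?thesis using assms
  proof (induction B rule: finite_induct)
    case (insert b B)
    have b: "b \<notin> vec.span B" "vec.independent B"
      using insert.prems insert.hyps vec.independent_insert[of b B] by auto
    have "vec.span (insert b B) = (\<lambda>(k, x). k *s b + x) ` (UNIV \<times> vec.span B)"
    proof (intro equalityI subsetI)
      fix x assume "x \<in> vec.span (insert b B)"
      then obtain k where "x - k *s b \<in> vec.span B" by (auto simp: vec.span_insert)
      then show "x \<in> (\<lambda>(k, x). k *s b + x) ` (UNIV \<times> vec.span B)"
        by (intro image_eqI[of _ _ "(k, x - k *s b)"]) auto
    next
      fix x assume "x \<in> (\<lambda>(k, x). k *s b + x) ` (UNIV \<times> vec.span B)"
      then obtain k y where "x = k *s b + y" "y \<in> vec.span B" by auto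
      then show "x \<in> vec.span (insert b B)"
        by (auto simp: vec.span_insert intro!: exI[of _ k])
    qed
    moreover have "inj_on (\<lambda>(k, x). k *s b + x) (UNIV \<times> vec.span B)"
    proof (rule inj_onI, clarsimp)
      fix k x k' x'
      assume *: "x \<in> vec.span B" "x' \<in> vec.span B" "k *s b + x = k' *s b + x'"
      then have eq: "(k - k') *s b = x' - x"
        by (simp add: vec.scale_left_diff_distrib algebra_simps)
      have "k = k'"
      proof (rule ccontr)
        assume "k \<noteq> k'"
        then have "b = inverse (k - k') *s (x' - x)" by (simp flip: eq)
        also have "\<dots> \<in> vec.span B" using * by (intro vec.span_scale vec.span_diff)
        finally show False using b by simp
      qed
      then show "k = k' \<and> x = x'" using * by simp
    qed
    ultimately show ?case
      using insert.IH b insert.hyps by (simp add: card_image card_cartesian_product)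
  qed simp
qed

text \<open>Dimensions enter the geometry through this count: injective maps between spread elements
  thereby become bijective.\<close>

lemma card_subspace:
  fixes U :: "('a::{field,finite} ^ 'm::finite) set"
  assumes "vec.subspace U"
  shows "card U = CARD('a) ^ vec.dim U"
proof -
  obtain B where "B \<subseteq> U" "vec.independent B" "U \<subseteq> vec.span B" "card B = vec.dim U"
    using vec.basis_exists by metis
  then show ?thesis
    using card_span_independent[of B] vec.span_minimal[of B U] assms by (simp add: subset_antisym)
qed

lemma sum_split:
  fixes f :: "'b \<Rightarrow> 'c::comm_monoid_add"
  assumes "I \<subseteq> A" "finite A"
  shows "sum f A = sum f I + sum f (A - I)"
  using assms by (simp add: sum.subset_diff add.commute)

lemma vec_span_subspace: "vec.subspace U \<Longrightarrow> vec.span U = U"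
  by simp

text \<open>Only the \<open>r\<close> spanning normal elements are fixed here. The extra one is kept
  apart because it serves one distributive law alone.\<close>

locale normal_frame =
  fixes S :: "('a::{field,finite} ^ 'm::finite) set set" and n r :: nat
    and E :: "nat \<Rightarrow> ('a ^ 'm) set"
  assumes n: "n \<ge> 1" and r: "r \<ge> 3" and dimension: "CARD('m) = r * n"
    and spread: "pg_spread (n - 1) S"
    and normal: "\<And>i. i < r \<Longrightarrow> normal_element S (E i)"
    and spanning: "vec.span (\<Union>i<r. E i) = UNIV"
begin

text \<open>
  The convention at \<open>0\<close>, which lies in every spread element, makes \<open>g \<in> cell v\<close> stable under
  projections that kill \<open>v\<close>.
\<close>

definition cell :: "'a ^ 'm \<Rightarrow> ('a ^ 'm) set" where
  "cell x = (if x = 0 then {0} else (THE U. U \<in> S \<and> x \<in> U))"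

text \<open>For a subspace this says that the elements of \<open>S\<close> through its nonzero
  vectors partition its points. The pointwise form is easy to pass on to spans.\<close>

definition closed :: "('a ^ 'm) set \<Rightarrow> bool" where
  "closed W \<longleftrightarrow> vec.subspace W \<and> (\<forall>x\<in>W. cell x \<subseteq> W)"

lemma S_subspace: "U \<in> S \<Longrightarrow> vec.subspace U"
  and S_dim: "U \<in> S \<Longrightarrow> vec.dim U = n"
  using spread n by (auto simp: pg_spread_def pg_subspace_def)

lemma pg_point_span:
  fixes x :: "'a ^ 'm"
  assumes "x \<noteq> 0" shows "pg_point (vec.span {x})"
  using assms by (simp add: pg_point_def pg_subspace_def)

lemma span_singleton_subset: 
  fixes x :: "'a ^ 'm"
  shows "vec.subspace U \<Longrightarrow> vec.span {x} \<subseteq> U \<longleftrightarrow> x \<in> U"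
  by (metis empty_subsetI insert_subset vec.span_minimal vec.span_superset subset_eq singletonI)

lemma partitions_points_ex1:
  assumes "partitions_points T W" "T \<subseteq> S" "vec.subspace W" "x \<in> W" "x \<noteq> 0"
  shows "\<exists>!U. U \<in> T \<and> x \<in> U"
proof -
  have "vec.span {x} \<subseteq> W" using assms span_singleton_subset by blast
  then have "\<exists>!U. U \<in> T \<and> vec.span {x} \<subseteq> U"
    using assms(1) pg_point_span[OF assms(5)] by (auto simp: partitions_points_def)
  moreover have "vec.span {x} \<subseteq> U \<longleftrightarrow> x \<in> U" if "U \<in> T" for U
    using that assms(2) S_subspace span_singleton_subset by blast
  ultimately show ?thesis by metis
qed

lemma ex1_S: "x \<noteq> 0 \<Longrightarrow> \<exists>!U. U \<in> S \<and> x \<in> U"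
  using spread by (intro partitions_points_ex1[of S UNIV]) (auto simp: pg_spread_def)

lemma cell_S: "x \<noteq> 0 \<Longrightarrow> cell x \<in> S" and cell_self [simp]: "x \<in> cell x"
  using theI'[OF ex1_S[of x]] by (auto simp: cell_def)

lemma cell_0 [simp]: "cell 0 = {0}"
  by (simp add: cell_def)

lemma S_cell: "U \<in> S \<Longrightarrow> x \<in> U \<Longrightarrow> x \<noteq> 0 \<Longrightarrow> cell x = U"
  using ex1_S[of x] cell_S[of x] cell_self[of x] by blast

lemma cell_subspace [simp]: "vec.subspace (cell x)"
  using cell_S S_subspace by (cases "x = 0") auto

lemma cell_eq: "y \<in> cell x \<Longrightarrow> y \<noteq> 0 \<Longrightarrow> cell y = cell x"
  by (metis S_cell cell_0 cell_S singletonD)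

lemma card_S: "U \<in> S \<Longrightarrow> card U = CARD('a) ^ n"
  by (simp add: card_subspace S_subspace S_dim)

section \<open>Joins with normal elements\<close>

lemma closed_subspace: "closed W \<Longrightarrow> vec.subspace W"
  and closed_cell: "closed W \<Longrightarrow> x \<in> W \<Longrightarrow> cell x \<subseteq> W"
  by (auto simp: closed_def)

lemma S_closed: "U \<in> S \<Longrightarrow> closed U"
  using S_cell S_subspace cell_0 by (fastforce simp: closed_def vec.subspace_0)

lemma cell_closed: "closed (cell x)"
  using S_closed cell_S by (cases "x = 0") (auto simp: closed_def)

text \<open>The partition given by normality consists of elements of \<open>S\<close>, so its member
  through a point is the spread element through that point. The case \<open>F = G\<close>, which the
  definition of normality leaves out, is included because \<open>F\<close> will be an arbitrary
  cell.\<close>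

lemma closed_span_normal_S:
  assumes "normal_element S G" "F \<in> S" shows "closed (vec.span (G \<union> F))"
proof (cases "F = G")
  case True
  then show ?thesis using assms S_closed S_subspace by (simp add: vec_span_subspace)
next
  case False
  then obtain T where T: "T \<subseteq> S" "partitions_points T (vec.span (G \<union> F))"
    using assms by (auto simp: normal_element_def)
  have "cell x \<subseteq> vec.span (G \<union> F)" if x: "x \<in> vec.span (G \<union> F)" "x \<noteq> 0" for x
  proof -
    obtain U where U: "U \<in> T" "x \<in> U"
      using partitions_points_ex1[OF T(2) T(1) _ x] by auto
    then have "cell x = U" using S_cell T x by blast
    then show ?thesis using T(2) U by (simp add: partitions_points_def)
  qed
  then show ?thesis unfolding closed_def
    by (metis cell_0 empty_subsetI insert_subset vec.span_zero vec.subspace_span)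
qed

lemma span_Un_subspace:
  fixes A B :: "('a ^ 'm) set"
  assumes "vec.subspace A" "vec.subspace B"
  shows "vec.span (A \<union> B) = {a + b | a b. a \<in> A \<and> b \<in> B}"
  using assms by (simp add: vec.span_Un vec_span_subspace)

text \<open>A point \<open>g + w\<close> already lies in the join of \<open>G\<close> with the
  single spread element through \<open>w\<close>, where normality applies directly.\<close>

lemma closed_span_normal:
  assumes G: "normal_element S G" and W: "closed W"
  shows "closed (vec.span (G \<union> W))"
  unfolding closed_def
proof (intro conjI ballI)
  show "vec.subspace (vec.span (G \<union> W))" by simp
  have GS: "G \<in> S" using G by (simp add: normal_element_def)
  fix x assume "x \<in> vec.span (G \<union> W)"
  then obtain g w where x: "x = g + w" "g \<in> G" "w \<in> W"
    using span_Un_subspace[OF S_subspace[OF GS] closed_subspace[OF W]] by auto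
  show "cell x \<subseteq> vec.span (G \<union> W)"
  proof (cases "w = 0")
    case True
    then have "cell x \<subseteq> G" using x S_closed[OF GS] by (simp add: closed_cell)
    also have "G \<subseteq> vec.span (G \<union> W)" by (meson le_sup_iff vec.span_superset)
    finally show ?thesis .
  next
    case False
    have "g + w \<in> vec.span (G \<union> cell w)"
      using x(2) by (intro vec.span_add vec.span_base) auto
    then have "cell x \<subseteq> vec.span (G \<union> cell w)"
      using closed_cell[OF closed_span_normal_S[OF G cell_S[OF False]]] x by simp
    also have "\<dots> \<subseteq> vec.span (G \<union> W)"
      using closed_cell[OF W x(3)] by (intro vec.span_mono) auto
    finally show ?thesis .
  qed
qed

lemma closed_span_family:
  assumes "finite I" "I \<subseteq> {..<r}" "closed W"
  shows "closed (vec.span (W \<union> (\<Union>i\<in>I. E i)))"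
  using assms(1,2)
proof (induction I rule: finite_induct)
  case empty
  then show ?case using assms(3) closed_subspace by (simp add: vec_span_subspace)
next
  case (insert i I)
  have "closed (vec.span (E i \<union> vec.span (W \<union> (\<Union>i\<in>I. E i))))"
    using insert by (intro closed_span_normal[OF normal]) auto
  moreover have "vec.span (E i \<union> vec.span (W \<union> (\<Union>i\<in>I. E i))) =
      vec.span (W \<union> (\<Union>i\<in>insert i I. E i))"
  proof (rule subset_antisym)
    show "vec.span (E i \<union> vec.span (W \<union> (\<Union>i\<in>I. E i))) \<subseteq> vec.span (W \<union> (\<Union>i\<in>insert i I. E i))"
      by (intro vec.span_minimal Un_least vec.subspace_span vec.span_mono)
         (auto intro: vec.span_base)
    show "vec.span (W \<union> (\<Union>i\<in>insert i I. E i)) \<subseteq> vec.span (E i \<union> vec.span (W \<union> (\<Union>i\<in>I. E i)))"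
      by (intro vec.span_minimal vec.subspace_span) (auto intro!: vec.span_base)
  qed
  ultimately show ?case by simp
qed

section \<open>The direct sum decomposition\<close>

lemma E_S: "i < r \<Longrightarrow> E i \<in> S"
  using normal by (simp add: normal_element_def)

lemma E_subspace: "i < r \<Longrightarrow> vec.subspace (E i)"
  using E_S S_subspace by blast

text \<open>The image is a subspace containing every \<open>E i\<close>, hence everything. Domain
  and codomain both have \<open>CARD('a) ^ (r * n)\<close> elements, so surjectivity gives
  injectivity.\<close>

lemma sum_bij: "bij_betw (\<lambda>x. \<Sum>i<r. x i) (PiE {..<r} E) UNIV"
proof -
  let ?s = "\<lambda>x. \<Sum>i<r. x i" and ?A = "PiE {..<r} E"
  have zero: "(\<lambda>i\<in>{..<r}. 0) \<in> ?A" using E_subspace by (auto simp: vec.subspace_0)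
  have "vec.subspace (?s ` ?A)"
    unfolding vec.subspace_def
  proof (intro conjI ballI allI)
    show "0 \<in> ?s ` ?A" using zero by (rule image_eqI[rotated]) simp
  next
    fix x y assume "x \<in> ?s ` ?A" "y \<in> ?s ` ?A"
    then obtain u v where u: "u \<in> ?A" "v \<in> ?A" "x = ?s u" "y = ?s v" by auto
    then show "x + y \<in> ?s ` ?A"
      by (intro image_eqI[of _ _ "\<lambda>i\<in>{..<r}. u i + v i"])
         (auto simp: sum.distrib intro!: vec.subspace_add E_subspace)
  next
    fix c x assume "x \<in> ?s ` ?A"
    then obtain u where u: "u \<in> ?A" "x = ?s u" by auto
    then show "c *s x \<in> ?s ` ?A"
      by (intro image_eqI[of _ _ "\<lambda>i\<in>{..<r}. c *s u i"])
         (auto simp: vec.scale_sum_right intro!: vec.subspace_scale E_subspace)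
  qed
  moreover have "E i \<subseteq> ?s ` ?A" if "i < r" for i
  proof
    fix x assume "x \<in> E i"
    then show "x \<in> ?s ` ?A"
      using that by (intro image_eqI[of _ _ "\<lambda>k\<in>{..<r}. if k = i then x else 0"])
         (auto simp: sum.delta vec.subspace_0 E_subspace)
  qed
  ultimately have "vec.span (\<Union>i<r. E i) \<subseteq> ?s ` ?A" by (intro vec.span_minimal) auto
  then have surj: "?s ` ?A = UNIV" using spanning by auto
  have "card ?A = (\<Prod>i<r. CARD('a) ^ n)" by (simp add: card_PiE card_S E_S)
  also have "\<dots> = CARD('a ^ 'm)" by (simp add: dimension power_mult[symmetric] mult.commute)
  finally have "inj_on ?s ?A"
    using surj by (intro eq_card_imp_inj_on) (auto intro!: finite_PiE)
  then show ?thesis using surj by (simp add: bij_betw_def)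
qed

definition proj :: "nat \<Rightarrow> 'a ^ 'm \<Rightarrow> 'a ^ 'm" where
  "proj i v = the_inv_into (PiE {..<r} E) (\<lambda>x. \<Sum>i<r. x i) v i"

lemma proj_in: "i < r \<Longrightarrow> proj i v \<in> E i" and sum_proj: "(\<Sum>i<r. proj i v) = v"
proof -
  let ?x = "the_inv_into (PiE {..<r} E) (\<lambda>x. \<Sum>i<r. x i) v"
  have b: "inj_on (\<lambda>x. \<Sum>i<r. x i) (PiE {..<r} E)" "(\<lambda>x. \<Sum>i<r. x i) ` (PiE {..<r} E) = UNIV"
    using sum_bij by (auto simp: bij_betw_def)
  have "?x \<in> PiE {..<r} E"
    using b by (intro the_inv_into_into[OF b(1)]) auto
  then show "i < r \<Longrightarrow> proj i v \<in> E i" by (auto simp: proj_def)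
  show "(\<Sum>i<r. proj i v) = v"
    unfolding proj_def using f_the_inv_into_f[OF b(1), of v] b(2) by auto
qed

lemma proj_unique:
  assumes "\<And>i. i < r \<Longrightarrow> x i \<in> E i" "(\<Sum>i<r. x i) = v" "i < r"
  shows "proj i v = x i"
proof -
  have "inj_on (\<lambda>x. \<Sum>i<r. x i) (PiE {..<r} E)" using sum_bij by (simp add: bij_betw_def)
  then have "(\<lambda>i\<in>{..<r}. proj i v) = (\<lambda>i\<in>{..<r}. x i)"
    by (rule inj_onD) (use assms proj_in sum_proj in auto)
  then show ?thesis using assms(3) by (metis lessThan_iff restrict_apply')
qed

lemma proj_add: "i < r \<Longrightarrow> proj i (u + v) = proj i u + proj i v"
  by (rule proj_unique) (auto simp: sum.distrib sum_proj intro!: vec.subspace_add E_subspace proj_in)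

lemma proj_scale: "i < r \<Longrightarrow> proj i (c *s v) = c *s proj i v"
  by (rule proj_unique)
     (auto simp: sum_proj simp flip: vec.scale_sum_right intro!: vec.subspace_scale E_subspace proj_in)

lemma proj_E: "i < r \<Longrightarrow> k < r \<Longrightarrow> x \<in> E i \<Longrightarrow> proj k x = (if k = i then x else 0)"
  by (rule proj_unique) (auto simp: sum.delta vec.subspace_0 E_subspace)

lemma proj_0 [simp]: "i < r \<Longrightarrow> proj i 0 = 0"
  using proj_scale[of i 0] by simp

lemma proj_diff: "i < r \<Longrightarrow> proj i (u - v) = proj i u - proj i v"
  using proj_add[of i "u - v" v] by simp

lemma proj_sum: "i < r \<Longrightarrow> proj i (\<Sum>k\<in>I. f k) = (\<Sum>k\<in>I. proj i (f k))"
  by (induction I rule: infinite_finite_induct) (simp_all add: proj_add)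

text \<open>For \<open>I \<subseteq> {..<r}\<close>, the projection onto the join of the
  \<open>E i\<close> with \<open>i \<in> I\<close> along the remaining ones.\<close>

definition sect :: "nat set \<Rightarrow> 'a ^ 'm \<Rightarrow> 'a ^ 'm" where
  "sect I v = (\<Sum>i\<in>I. proj i v)"

lemma proj_sect: "I \<subseteq> {..<r} \<Longrightarrow> k < r \<Longrightarrow> proj k (sect I v) = (if k \<in> I then proj k v else 0)"
proof -
  assume I: "I \<subseteq> {..<r}" and k: "k < r"
  have "proj k (sect I v) = (\<Sum>i\<in>I. proj k (proj i v))"
    using k by (simp add: sect_def proj_sum)
  also have "\<dots> = (\<Sum>i\<in>I. if i = k then proj k v else 0)"
    using I k by (intro sum.cong) (auto simp: proj_E[OF _ k proj_in])
  also have "\<dots> = (if k \<in> I then proj k v else 0)"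
    using I by (simp add: finite_subset sum.delta)
  finally show ?thesis .
qed

lemma vec_eqI: "(\<And>i. i < r \<Longrightarrow> proj i u = proj i v) \<Longrightarrow> u = v"
  using sum_proj[of u] sum_proj[of v] by (metis (no_types, lifting) lessThan_iff sum.cong)

lemma span_E_subset:
  assumes "I \<subseteq> {..<r}" "v \<in> vec.span (\<Union>i\<in>I. E i)" "k < r" "k \<notin> I"
  shows "proj k v = 0"
proof -
  have "vec.subspace {v. proj k v = 0}"
    using assms(3) by (auto simp: vec.subspace_def proj_add proj_scale)
  moreover have "(\<Union>i\<in>I. E i) \<subseteq> {v. proj k v = 0}"
    using assms by (auto simp: proj_E)
  ultimately show ?thesis using assms(2) vec.span_minimal by blast
qed

text \<open>The vector \<open>v\<close> lies in the join of \<open>cell (sect I v)\<close> with all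
  \<open>E j\<close> for \<open>j\<close> outside \<open>I\<close>. This join is closed, so it
  contains \<open>g\<close>, and the projection discards the part of \<open>g\<close> in the
  \<open>E j\<close>. If \<open>sect I v = 0\<close>, the convention for \<open>cell\<close> yields
  \<open>sect I g = 0\<close>.\<close>

lemma sect_cell:
  assumes g: "g \<in> cell v" and I: "I \<subseteq> {..<r}"
  shows "sect I g \<in> cell (sect I v)"
proof -
  have fin: "finite I" using I finite_subset by blast
  let ?J = "{..<r} - I"
  have "closed {0}" by (simp add: closed_def vec.subspace_def)
  then have WI: "closed (vec.span (\<Union>i\<in>I. E i))"
    using closed_span_family[of I "{0}"] fin I by (simp add: vec.span_insert_0)
  have "sect I v \<in> vec.span (\<Union>i\<in>I. E i)"
    unfolding sect_def using I proj_in by (intro vec.span_sum vec.span_base) blast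
  then have cI: "cell (sect I v) \<subseteq> vec.span (\<Union>i\<in>I. E i)" by (rule closed_cell[OF WI])
  let ?W = "vec.span (cell (sect I v) \<union> (\<Union>i\<in>?J. E i))"
  have W: "closed ?W" by (rule closed_span_family) (auto simp: cell_closed)
  have "v = sect I v + sect ?J v"
    using sum_split[OF I, of "\<lambda>i. proj i v"] sum_proj[of v] by (simp add: sect_def)
  moreover have "sect ?J v \<in> ?W"
    unfolding sect_def using proj_in by (intro vec.span_sum vec.span_base) blast
  moreover have "sect I v \<in> ?W" by (intro vec.span_base) auto
  ultimately have "v \<in> ?W" using vec.span_add by metis
  then have "g \<in> ?W" using closed_cell[OF W] g by blast
  then obtain a b where ab: "g = a + b" "a \<in> cell (sect I v)" "b \<in> vec.span (\<Union>i\<in>?J. E i)"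
    by (auto simp: vec.span_Un vec_span_subspace)
  have "sect I g = a"
  proof (rule vec_eqI)
    fix k assume k: "k < r"
    show "proj k (sect I g) = proj k a"
    proof (cases "k \<in> I")
      case True
      then have "proj k b = 0" using span_E_subset[of ?J b k] ab k by auto
      then show ?thesis using True k ab I by (simp add: proj_sect proj_add)
    next
      case False
      then have "proj k a = 0" using span_E_subset[of I a k] ab cI k I by auto
      then show ?thesis using False k I by (simp add: proj_sect)
    qed
  qed
  then show ?thesis using ab by simp
qed

lemma sect_single: "sect {i} v = proj i v"
  by (simp add: sect_def)

text \<open>If some nonzero \<open>g\<close> in \<open>cell v\<close> had
  \<open>proj i g = 0\<close>, then \<open>v \<in> cell g\<close>, and \<open>sect_cell\<close> with
  the roles exchanged would give \<open>proj i v = 0\<close>. So the projection is injective, and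
  counting makes it onto.\<close>

lemma proj_cell_bij:
  assumes i: "i < r" and v: "proj i v \<noteq> 0"
  shows "bij_betw (proj i) (cell v) (E i)"
proof -
  have nz: "g = 0" if g: "g \<in> cell v" "proj i g = 0" for g
  proof (rule ccontr)
    assume "g \<noteq> 0"
    then have "v \<in> cell g" using cell_eq[OF g(1)] by simp
    then have "proj i v \<in> cell (proj i g)" using sect_cell[of v g "{i}"] i by (simp add: sect_single)
    then show False using g v by simp
  qed
  have "inj_on (proj i) (cell v)"
  proof (rule inj_onI)
    fix x y assume xy: "x \<in> cell v" "y \<in> cell v" "proj i x = proj i y"
    have "proj i (x - y) = 0" using xy i by (simp add: proj_diff)
    moreover have "x - y \<in> cell v" using xy by (intro vec.subspace_diff cell_subspace)
    ultimately show "x = y" using nz by fastforce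
  qed
  moreover have "v \<noteq> 0" using v i by auto
  ultimately have "proj i ` cell v = E i"
    using i by (intro card_subset_eq) (auto simp: proj_in card_image card_S E_S cell_S)
  with \<open>inj_on (proj i) (cell v)\<close> show ?thesis by (simp add: bij_betw_def)
qed

end

subsection \<open>The associated nearfield\<close>

text \<open>The unit point \<open>e\<close> stays a parameter: it is later taken inside the extra
  normal element when possible, and otherwise as a sum of nonzero vectors from the
  \<open>E i\<close>.\<close>

locale normal_frame_unit = normal_frame S n r E
  for S :: "('a::{field,finite} ^ 'm::finite) set set" and n r E +
  fixes e :: "'a ^ 'm"
  assumes e: "\<And>i. i < r \<Longrightarrow> proj i e \<noteq> 0"
begin

definition F :: "('a ^ 'm) set" where "F = cell e"

lemma e_nonzero: "e \<noteq> 0"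
  using e[of 0] r by auto

lemma F_S: "F \<in> S"
  by (simp add: F_def cell_S e_nonzero)

lemma F_subspace: "vec.subspace F"
  by (simp add: F_def)

lemma e_F [simp]: "e \<in> F" and zero_F [simp]: "0 \<in> F"
  by (simp_all add: F_def vec.subspace_0)

lemma F_add [simp]: "x \<in> F \<Longrightarrow> y \<in> F \<Longrightarrow> x + y \<in> F"
  and F_diff [simp]: "x \<in> F \<Longrightarrow> y \<in> F \<Longrightarrow> x - y \<in> F"
  and F_uminus [simp]: "x \<in> F \<Longrightarrow> - x \<in> F"
  and F_scale [simp]: "x \<in> F \<Longrightarrow> c *s x \<in> F"
  by (simp_all add: F_subspace vec.subspace_add vec.subspace_diff vec.subspace_neg vec.subspace_scale)

lemma proj_bij: "i < r \<Longrightarrow> bij_betw (proj i) F (E i)"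
  unfolding F_def by (rule proj_cell_bij) (auto simp: e)

text \<open>Each \<open>E i\<close> is identified with \<open>F\<close> through
  \<open>proj i\<close>, so coordinates are vectors of \<open>F\<close>. In this system
  \<open>F\<close> is the diagonal: every coordinate of \<open>x \<in> F\<close> is
  \<open>x\<close>.\<close>

definition coord :: "nat \<Rightarrow> 'a ^ 'm \<Rightarrow> 'a ^ 'm" where
  "coord i v = the_inv_into F (proj i) (proj i v)"

lemma coord_F [simp]: "i < r \<Longrightarrow> coord i v \<in> F"
  and proj_coord: "i < r \<Longrightarrow> proj i (coord i v) = proj i v"
proof -
  assume i: "i < r"
  have b: "inj_on (proj i) F" "proj i ` F = E i" using proj_bij[OF i] by (auto simp: bij_betw_def)
  show "coord i v \<in> F"
    unfolding coord_def using proj_in[OF i] b by (intro the_inv_into_into[OF b(1)]) auto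
  show "proj i (coord i v) = proj i v"
    unfolding coord_def using proj_in[OF i] b by (intro f_the_inv_into_f) auto
qed

lemma coord_eqI: "i < r \<Longrightarrow> x \<in> F \<Longrightarrow> proj i x = proj i v \<Longrightarrow> coord i v = x"
  by (metis bij_betw_imp_inj_on coord_F inj_onD proj_bij proj_coord)

lemma coord_id [simp]: "i < r \<Longrightarrow> x \<in> F \<Longrightarrow> coord i x = x"
  by (rule coord_eqI) auto

lemma coord_add [simp]: "i < r \<Longrightarrow> coord i (u + v) = coord i u + coord i v"
  by (rule coord_eqI) (auto simp: proj_add proj_coord)

lemma coord_scale [simp]: "i < r \<Longrightarrow> coord i (c *s v) = c *s coord i v"
  by (rule coord_eqI) (auto simp: proj_scale proj_coord)

lemma coord_eq_0_iff: "i < r \<Longrightarrow> coord i v = 0 \<longleftrightarrow> proj i v = 0"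
  by (metis coord_eqI proj_0 proj_coord zero_F)

lemma coord_proj: "i < r \<Longrightarrow> k < r \<Longrightarrow> coord k (proj i v) = (if k = i then coord i v else 0)"
  by (rule coord_eqI) (auto simp: proj_E[OF _ _ proj_in] proj_coord)

lemma coord_ext: "(\<And>i. i < r \<Longrightarrow> coord i u = coord i v) \<Longrightarrow> u = v"
  by (rule vec_eqI) (metis proj_coord)

definition assemble :: "(nat \<Rightarrow> 'a ^ 'm) \<Rightarrow> 'a ^ 'm" where
  "assemble c = (\<Sum>i<r. proj i (c i))"

lemma coord_assemble [simp]: "k < r \<Longrightarrow> (\<And>i. i < r \<Longrightarrow> c i \<in> F) \<Longrightarrow> coord k (assemble c) = c k"
proof (rule coord_eqI)
  assume k: "k < r" and c: "\<And>i. i < r \<Longrightarrow> c i \<in> F"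
  show "proj k (c k) = proj k (assemble c)"
    using k by (simp add: assemble_def proj_sum proj_E[OF _ _ proj_in])
qed auto

lemma coord_cell_bij:
  assumes i: "i < r" and v: "coord i v \<noteq> 0"
  shows "bij_betw (coord i) (cell v) F"
proof -
  have "bij_betw (the_inv_into F (proj i) \<circ> proj i) (cell v) F"
    using proj_cell_bij[of i v] bij_betw_the_inv_into[OF proj_bij[OF i]] i v
    by (intro bij_betw_trans) (auto simp: coord_eq_0_iff)
  then show ?thesis by (simp add: coord_def[abs_def] o_def)
qed

lemma coord_cell_0: "i < r \<Longrightarrow> g \<in> cell v \<Longrightarrow> coord i v = 0 \<Longrightarrow> coord i g = 0"
  using sect_cell[of g v "{i}"] by (simp add: sect_single coord_eq_0_iff)

lemma cell_point: 
  assumes "i < r" "coord i v \<noteq> 0" "x \<in> F"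
  obtains g where "g \<in> cell v" "coord i g = x"
  using coord_cell_bij[OF assms(1,2)] assms(3) by (metis bij_betw_imp_surj_on imageE)

lemma cell_inj: "i < r \<Longrightarrow> coord i v \<noteq> 0 \<Longrightarrow> g \<in> cell v \<Longrightarrow> h \<in> cell v \<Longrightarrow> coord i g = coord i h \<Longrightarrow> g = h"
  using coord_cell_bij by (auto simp: bij_betw_def dest: inj_onD)

section \<open>Multiplication in a coordinate plane\<close>

definition pair :: "nat \<Rightarrow> nat \<Rightarrow> 'a ^ 'm \<Rightarrow> 'a ^ 'm \<Rightarrow> 'a ^ 'm" where
  "pair i k x y = proj i x + proj k y"

lemma coord_pair:
  assumes "i < r" "k < r" "i \<noteq> k" "l < r" "x \<in> F" "y \<in> F"
  shows "coord l (pair i k x y) = (if l = i then x else if l = k then y else 0)"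
  using assms by (simp add: pair_def coord_proj)

lemma sect_pair:
  assumes "i < r" "k < r" "i \<noteq> k"
  shows "sect {i, k} v = pair i k (coord i v) (coord k v)"
  using assms by (simp add: sect_def pair_def proj_coord)

text \<open>In the plane of coordinates \<open>i\<close> and \<open>k\<close>, the spread element
  through the point \<open>(e, w)\<close> is the graph of \<open>pmul i k w\<close>; thus
  \<open>w\<close> plays the role of a slope.\<close>

definition pmul :: "nat \<Rightarrow> nat \<Rightarrow> 'a ^ 'm \<Rightarrow> 'a ^ 'm \<Rightarrow> 'a ^ 'm" where
  "pmul i k w x = coord k (the_inv_into (cell (pair i k e w)) (coord i) x)"

text \<open>Projecting to the coordinates \<open>i\<close> and \<open>k\<close> maps the spread
  element through \<open>v\<close> into the one through \<open>(e, coord k v)\<close>, so slopes can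
  be read off in the whole space.\<close>

lemma pmul_cell:
  assumes "i < r" "k < r" "i \<noteq> k" and g: "g \<in> cell v" and v: "coord i v = e"
  shows "coord k g = pmul i k (coord k v) (coord i g)"
proof -
  let ?p = "pair i k e (coord k v)"
  have p: "coord i ?p \<noteq> 0" using assms by (simp add: coord_pair e_nonzero)
  have "sect {i, k} g \<in> cell (sect {i, k} v)" using assms by (intro sect_cell) auto
  then have "pair i k (coord i g) (coord k g) \<in> cell ?p" using assms by (simp add: sect_pair)
  moreover have "coord i (pair i k (coord i g) (coord k g)) = coord i g"
    using assms by (simp add: coord_pair)
  ultimately have "the_inv_into (cell ?p) (coord i) (coord i g) = pair i k (coord i g) (coord k g)"
    using coord_cell_bij[OF assms(1) p] by (intro the_inv_into_f_eq) (auto simp: bij_betw_def)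
  then show ?thesis using assms by (simp add: pmul_def coord_pair)
qed

text \<open>A spread element with nonzero coordinate \<open>i\<close> contains a point where this
  coordinate is \<open>e\<close>; the coordinate \<open>k\<close> of that point is the
  slope.\<close>

lemma pmul_coherent:
  assumes "i < r" "k < r" "i \<noteq> k" "coord i v \<noteq> 0"
  obtains w where "w \<in> F" "\<And>g. g \<in> cell v \<Longrightarrow> coord k g = pmul i k w (coord i g)"
proof -
  obtain v' where v': "v' \<in> cell v" "coord i v' = e" using cell_point[OF assms(1,4) e_F] .
  then have "v' \<noteq> 0" using e_nonzero assms by auto
  then have "cell v' = cell v" using cell_eq v' by blast
  then show ?thesis using that[of "coord k v'"] pmul_cell[OF assms(1-3) _ v'(2)] assms by simp
qed

lemma pmul_point:
  assumes "i < r" "k < r" "i \<noteq> k" "w \<in> F" "x \<in> F"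
  obtains g where "g \<in> cell (pair i k e w)" "coord i g = x" "coord k g = pmul i k w x"
proof -
  have "coord i (pair i k e w) = e" "coord k (pair i k e w) = w" using assms by (simp_all add: coord_pair)
  then show ?thesis
    using cell_point[of i "pair i k e w" x] pmul_cell[of i k _ "pair i k e w"] assms e_nonzero that
    by metis
qed

lemma pmul_F [simp]: "i < r \<Longrightarrow> k < r \<Longrightarrow> i \<noteq> k \<Longrightarrow> w \<in> F \<Longrightarrow> x \<in> F \<Longrightarrow> pmul i k w x \<in> F"
  by (metis pmul_point coord_F)

lemma pmul_e_right [simp]: "i < r \<Longrightarrow> k < r \<Longrightarrow> i \<noteq> k \<Longrightarrow> w \<in> F \<Longrightarrow> pmul i k w e = w"
  using pmul_cell[of i k "pair i k e w" "pair i k e w"] by (simp add: coord_pair)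

lemma pmul_e_left [simp]: "i < r \<Longrightarrow> k < r \<Longrightarrow> i \<noteq> k \<Longrightarrow> x \<in> F \<Longrightarrow> pmul i k e x = x"
  using pmul_cell[of i k x e] by (simp add: F_def[symmetric])

lemma pmul_0_left [simp]: "i < r \<Longrightarrow> k < r \<Longrightarrow> i \<noteq> k \<Longrightarrow> x \<in> F \<Longrightarrow> pmul i k 0 x = 0"
  using pmul_point[of i k 0 x] coord_cell_0[of k _ "pair i k e 0"] by (metis coord_pair e_F zero_F)

lemma pmul_0_right [simp]: "i < r \<Longrightarrow> k < r \<Longrightarrow> i \<noteq> k \<Longrightarrow> w \<in> F \<Longrightarrow> pmul i k w 0 = 0"
  using pmul_cell[of i k 0 "pair i k e w"] by (simp add: coord_pair vec.subspace_0)

text \<open>Spread elements are subspaces, so they are graphs of additive maps. This distributive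
  law is available before the extra normal element appears.\<close>

lemma pmul_add_right:
  assumes "i < r" "k < r" "i \<noteq> k" "w \<in> F" "x \<in> F" "y \<in> F"
  shows "pmul i k w (x + y) = pmul i k w x + pmul i k w y"
proof -
  obtain g h where g: "g \<in> cell (pair i k e w)" "coord i g = x" "coord k g = pmul i k w x"
    and h: "h \<in> cell (pair i k e w)" "coord i h = y" "coord k h = pmul i k w y"
    using pmul_point[OF assms(1-4)] assms(5,6) by metis
  then have "coord k (g + h) = pmul i k (coord k (pair i k e w)) (coord i (g + h))"
    using assms by (intro pmul_cell vec.subspace_add) (auto simp: coord_pair)
  then show ?thesis using assms g h by (simp add: coord_pair)
qed

lemma pmul_scale_right:
  assumes "i < r" "k < r" "i \<noteq> k" "w \<in> F" "x \<in> F"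
  shows "pmul i k w (c *s x) = c *s pmul i k w x"
proof -
  obtain g where g: "g \<in> cell (pair i k e w)" "coord i g = x" "coord k g = pmul i k w x"
    using pmul_point[OF assms] by metis
  then have "coord k (c *s g) = pmul i k (coord k (pair i k e w)) (coord i (c *s g))"
    using assms by (intro pmul_cell vec.subspace_scale) (auto simp: coord_pair)
  then show ?thesis using assms g by (simp add: coord_pair)
qed

text \<open>Two slopes with the same value at \<open>x \<noteq> 0\<close> give spread elements
  sharing a nonzero point. They coincide, and then so do their points with coordinate
  \<open>i\<close> equal to \<open>e\<close>.\<close>

lemma pmul_inj_left:
  assumes "i < r" "k < r" "i \<noteq> k" "w \<in> F" "w' \<in> F" "x \<in> F" "x \<noteq> 0" "pmul i k w x = pmul i k w' x"
  shows "w = w'"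
proof -
  have in_cell: "pair i k x (pmul i k u x) \<in> cell (pair i k e u)" if u: "u \<in> F" for u
  proof -
    obtain g where g: "g \<in> cell (pair i k e u)" "coord i g = x" "coord k g = pmul i k u x"
      using pmul_point[OF assms(1-3) u assms(6)] by metis
    have "sect {i, k} g \<in> cell (sect {i, k} (pair i k e u))" using assms g by (intro sect_cell) auto
    then show ?thesis using g u assms by (simp add: sect_pair coord_pair)
  qed
  have "pair i k x (pmul i k w x) \<noteq> 0"
    using coord_pair[OF assms(1-3,1,6), of "pmul i k w x"] assms by auto
  then have eq: "cell (pair i k e w) = cell (pair i k e w')"
    using in_cell[of w] in_cell[of w'] cell_eq assms by metis
  have "pair i k e w = pair i k e w'"
  proof (rule cell_inj[OF assms(1)])
    show "pair i k e w \<in> cell (pair i k e w')" unfolding eq[symmetric] by simp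
  qed (use assms e_nonzero in \<open>simp_all add: coord_pair\<close>)
  then show ?thesis using coord_pair[OF assms(1-3,2) e_F] assms by metis
qed

lemma pmul_solve_left:
  assumes "i < r" "k < r" "i \<noteq> k" "x \<in> F" "x \<noteq> 0" "y \<in> F"
  obtains w where "w \<in> F" "pmul i k w x = y"
proof -
  have "coord i (pair i k x y) \<noteq> 0" using assms by (simp add: coord_pair)
  then obtain w where "w \<in> F" "\<And>g. g \<in> cell (pair i k x y) \<Longrightarrow> coord k g = pmul i k w (coord i g)"
    using pmul_coherent assms by metis
  from this(1) this(2)[of "pair i k x y"] show ?thesis using that assms by (simp add: coord_pair)
qed

text \<open>The spread element through the point with coordinates \<open>e\<close>, \<open>w\<close>
  and \<open>pmul k l w' w\<close> at \<open>i\<close>, \<open>k\<close> and \<open>l\<close> is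
  read in three planes: its slope from \<open>i\<close> to \<open>k\<close> is \<open>w\<close>,
  from \<open>k\<close> to \<open>l\<close> it is \<open>w'\<close>, and from \<open>i\<close> to
  \<open>l\<close> it is the product. Composing the first two gives the third.\<close>

lemma pmul_assoc3:
  assumes ikl: "i < r" "k < r" "l < r" "i \<noteq> k" "k \<noteq> l" "i \<noteq> l" and F: "w' \<in> F" "w \<in> F" "x \<in> F"
  shows "pmul i l (pmul k l w' w) x = pmul k l w' (pmul i k w x)"
\<comment> \<open>For \<open>w = 0\<close> the coordinate \<open>k\<close> vanishes on the spread
  element and determines no slope to \<open>l\<close>.\<close>
proof (cases "w = 0")
  case True
  then show ?thesis using assms by simp
next
  case False
  let ?u = "pmul k l w' w"
  define v where "v = pair i k e w + proj l ?u"
  have v: "coord i v = e" "coord k v = w" "coord l v = ?u"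
    using assms by (simp_all add: v_def coord_pair coord_proj)
  obtain g where g: "g \<in> cell v" "coord i g = x" using cell_point[of i v x] v e_nonzero assms by auto
  obtain w'' where w'': "w'' \<in> F" "\<And>g. g \<in> cell v \<Longrightarrow> coord l g = pmul k l w'' (coord k g)"
    using pmul_coherent[of k l v] v False assms by auto
  have "pmul k l w' w = pmul k l w'' w" using w''(2)[of v] v by simp
  then have "w'' = w'" using pmul_inj_left[of k l w'' w' w] w'' assms False by simp
  then have "coord l g = pmul k l w' (pmul i k w x)"
    using w''(2)[OF g(1)] pmul_cell[of i k g v] g v assms by simp
  moreover have "coord l g = pmul i l ?u x" using pmul_cell[of i l g v] g v assms by simp
  ultimately show ?thesis by simp
qed

text \<open>With \<open>e\<close> as the middle factor, both inner products in
  \<open>pmul_assoc3\<close> collapse.\<close>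

lemma pmul_change_first:
  assumes "i < r" "k < r" "l < r" "i \<noteq> l" "k \<noteq> l" "w \<in> F" "x \<in> F"
  shows "pmul i l w x = pmul k l w x"
  using assms pmul_assoc3[of i k l w e x] by (cases "i = k") auto

text \<open>For \<open>w \<noteq> 0\<close> the spread element through \<open>(e, w)\<close> is also
  a graph over the coordinate \<open>k\<close>.\<close>

lemma pmul_inverse:
  assumes "i < r" "k < r" "i \<noteq> k" "w \<in> F" "w \<noteq> 0"
  obtains w' where "w' \<in> F" "\<And>x. x \<in> F \<Longrightarrow> pmul k i w' (pmul i k w x) = x"
proof -
  have "coord k (pair i k e w) \<noteq> 0" using assms by (simp add: coord_pair)
  then obtain w' where "w' \<in> F" "\<And>g. g \<in> cell (pair i k e w) \<Longrightarrow> coord i g = pmul k i w' (coord k g)"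
    using pmul_coherent[of k i "pair i k e w"] assms by metis
  then show ?thesis using that pmul_point[OF assms(1-4)] by metis
qed

lemma pmul_surj_right:
  assumes "i < r" "k < r" "i \<noteq> k" "w \<in> F" "w \<noteq> 0" "y \<in> F"
  obtains x where "x \<in> F" "pmul i k w x = y"
proof -
  have "inj_on (pmul i k w) F" using pmul_inverse[OF assms(1-5)] by (metis inj_on_inverseI)
  moreover have "pmul i k w ` F \<subseteq> F" using assms by auto
  ultimately have "pmul i k w ` F = F" by (simp add: endo_inj_surj)
  then show ?thesis using that assms(6) by (metis imageE)
qed

text \<open>If \<open>w\<close> is chosen with \<open>pmul k l w' w = e\<close>, associativity makes
  \<open>pmul k l w'\<close> the inverse of \<open>pmul i k w\<close>. Some
  \<open>pmul k i w''\<close> inverts the same map, and evaluating at \<open>e\<close> shows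
  \<open>w'' = w'\<close>.\<close>

lemma pmul_change_second:
  assumes ikl: "i < r" "k < r" "l < r" "i \<noteq> k" "k \<noteq> l" "i \<noteq> l" and F: "w' \<in> F" "y \<in> F"
  shows "pmul k l w' y = pmul k i w' y"
proof (cases "w' = 0")
  case True
  then show ?thesis using assms by simp
next
  case False
  obtain w where w: "w \<in> F" "pmul k l w' w = e" using pmul_surj_right[of k l w' e] assms False by auto
  then have "w \<noteq> 0" using e_nonzero assms by auto
  then obtain w'' where w'': "w'' \<in> F" "\<And>x. x \<in> F \<Longrightarrow> pmul k i w'' (pmul i k w x) = x"
    using pmul_inverse[of i k w] assms w by metis
  have inv: "pmul k l w' (pmul i k w x) = x" if "x \<in> F" for x
    using pmul_assoc3[of i k l w' w x] assms w that by simp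
  have eq: "pmul k l w' z = pmul k i w'' z" if z: "z \<in> F" for z
  proof -
    obtain x where "x \<in> F" "pmul i k w x = z" using pmul_surj_right[of i k w z] assms w \<open>w \<noteq> 0\<close> z by auto
    then show ?thesis using inv w''(2) by metis
  qed
  then have "w' = w''" using eq[of e] assms w'' by simp
  then show ?thesis using eq F by simp
qed

section \<open>The common multiplication of all coordinate planes\<close>

definition mul :: "'a ^ 'm \<Rightarrow> 'a ^ 'm \<Rightarrow> 'a ^ 'm" where
  "mul = pmul 0 1"

lemma pmul_eq_mul:
  assumes "i < r" "k < r" "i \<noteq> k" "w \<in> F" "x \<in> F"
  shows "pmul i k w x = mul w x"
proof -
  have step: "pmul j 1 w x = mul w x" if "j < r" "j \<noteq> 1" for j
    unfolding mul_def using pmul_change_first[of j 0 1] that assms r by simp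
  have step': "pmul j k w x = mul w x" if j: "j < r" "j \<noteq> 1" "j \<noteq> k" for j
    using pmul_change_second[of 1 j k w x] step[of j] j assms r by (cases "k = 1") auto
  \<comment> \<open>An index other than 1 and \<open>k\<close> exists because
    \<open>r \<ge> 3\<close>; \<open>pmul_change_first\<close> replaces \<open>i\<close> by it, and
    \<open>step'\<close> then applies.\<close>
  obtain t where t: "t < r" "t \<noteq> 1" "t \<noteq> k"
  proof -
    show ?thesis
    proof (cases "k = 0")
      case True
      then show ?thesis using that[of 2] r by simp
    next
      case False
      then show ?thesis using that[of 0] r by simp
    qed
  qed
  show ?thesis using pmul_change_first[of i t k w x] step'[of t] t assms by simp
qed

lemma mul_F [simp]: "a \<in> F \<Longrightarrow> b \<in> F \<Longrightarrow> mul a b \<in> F"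
  and mul_e_right [simp]: "a \<in> F \<Longrightarrow> mul a e = a"
  and mul_e_left [simp]: "a \<in> F \<Longrightarrow> mul e a = a"
  and mul_0_left [simp]: "a \<in> F \<Longrightarrow> mul 0 a = 0"
  and mul_0_right [simp]: "a \<in> F \<Longrightarrow> mul a 0 = 0"
  and mul_add_right: "a \<in> F \<Longrightarrow> b \<in> F \<Longrightarrow> c \<in> F \<Longrightarrow> mul a (b + c) = mul a b + mul a c"
  and mul_scale_right: "a \<in> F \<Longrightarrow> b \<in> F \<Longrightarrow> mul a (s *s b) = s *s mul a b"
  using r by (simp_all add: mul_def pmul_add_right pmul_scale_right)

lemma mul_inj_left: "a \<in> F \<Longrightarrow> b \<in> F \<Longrightarrow> c \<in> F \<Longrightarrow> c \<noteq> 0 \<Longrightarrow> mul a c = mul b c \<Longrightarrow> a = b"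
  using pmul_inj_left[of 0 1 a b c] r by (simp add: mul_def)

lemma mul_solve_left: "a \<in> F \<Longrightarrow> a \<noteq> 0 \<Longrightarrow> b \<in> F \<Longrightarrow> \<exists>c\<in>F. mul c a = b"
  using pmul_solve_left[of 0 1 a b] r unfolding mul_def by auto

lemma mul_solve_right: "a \<in> F \<Longrightarrow> a \<noteq> 0 \<Longrightarrow> b \<in> F \<Longrightarrow> \<exists>c\<in>F. mul a c = b"
  using pmul_surj_right[of 0 1 a b] r unfolding mul_def by auto

lemma mul_diff_right: "a \<in> F \<Longrightarrow> b \<in> F \<Longrightarrow> c \<in> F \<Longrightarrow> mul a (b - c) = mul a b - mul a c"
  using mul_add_right[of a "b - c" c] by (simp add: algebra_simps)

lemma mul_eq_0: "a \<in> F \<Longrightarrow> b \<in> F \<Longrightarrow> mul a b = 0 \<Longrightarrow> a = 0 \<or> b = 0"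
  using mul_inj_left[of a 0 b] by auto

lemma mul_inj_right: "a \<in> F \<Longrightarrow> b \<in> F \<Longrightarrow> c \<in> F \<Longrightarrow> a \<noteq> 0 \<Longrightarrow> mul a b = mul a c \<Longrightarrow> b = c"
  using mul_eq_0[of a "b - c"] by (auto simp: mul_diff_right)

lemma mul_assoc: "a \<in> F \<Longrightarrow> b \<in> F \<Longrightarrow> c \<in> F \<Longrightarrow> mul (mul a b) c = mul a (mul b c)"
  using pmul_assoc3[of 0 1 2 a b c] r by (simp add: pmul_eq_mul)

lemma mul_cell:
  assumes "i < r" "k < r" "i \<noteq> k" "g \<in> cell v" "coord i v = e"
  shows "coord k g = mul (coord k v) (coord i g)"
  using pmul_cell[OF assms] assms by (simp add: pmul_eq_mul)

lemma mul_coherent: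
  assumes "i < r" "k < r" "i \<noteq> k" "coord i v \<noteq> 0"
  obtains w where "w \<in> F" "\<And>g. g \<in> cell v \<Longrightarrow> coord k g = mul w (coord i g)"
  using pmul_coherent[OF assms] assms by (metis coord_F pmul_eq_mul)

lemma assemble_coord: "assemble (\<lambda>i. coord i v) = v"
  by (rule coord_ext) simp

text \<open>At an index with \<open>c i \<noteq> 0\<close>, coherence writes each other
  \<open>c k\<close> as a left multiple of \<open>c i\<close>. By associativity, multiplying all
  coordinates by \<open>x\<close> on the right respects these relations.\<close>

lemma assemble_mul_cell:
  assumes c: "\<And>i. i < r \<Longrightarrow> c i \<in> F" and x: "x \<in> F"
  shows "assemble (\<lambda>i. mul (c i) x) \<in> cell (assemble c)"
proof (cases "\<forall>i<r. c i = 0")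
  case True
  then have "assemble (\<lambda>i. mul (c i) x) = 0" using x by (simp add: assemble_def)
  then show ?thesis by (simp add: vec.subspace_0)
next
  case False
  then obtain i where i: "i < r" "c i \<noteq> 0" by auto
  let ?v = "assemble c"
  have v: "coord k ?v = c k" if "k < r" for k using c that by simp
  obtain g where g: "g \<in> cell ?v" "coord i g = mul (c i) x"
    using cell_point[of i ?v "mul (c i) x"] i c x v by auto
  have "assemble (\<lambda>i. mul (c i) x) = g"
  proof (rule coord_ext)
    fix k assume k: "k < r"
    have "coord k g = mul (c k) x"
    proof (cases "k = i")
      case False
      obtain w where w: "w \<in> F" "\<And>g. g \<in> cell ?v \<Longrightarrow> coord k g = mul w (coord i g)"
        using mul_coherent[of i k ?v] i k False v by auto
      have "c k = mul w (c i)" using w(2)[of ?v] v i k by simp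
      then show ?thesis using w(2)[OF g(1)] g(2) mul_assoc[of w "c i" x] w(1) c i x by simp
    qed (use g in simp)
    then show "coord k (assemble (\<lambda>i. mul (c i) x)) = coord k g" using k c x by simp
  qed
  then show ?thesis using g by simp
qed

lemma cell_assemble:
  assumes c: "\<And>i. i < r \<Longrightarrow> c i \<in> F" and nz: "assemble c \<noteq> 0"
  shows "cell (assemble c) = (\<lambda>x. assemble (\<lambda>i. mul (c i) x)) ` F"
proof
  show "(\<lambda>x. assemble (\<lambda>i. mul (c i) x)) ` F \<subseteq> cell (assemble c)"
    using assemble_mul_cell c by auto
  show "cell (assemble c) \<subseteq> (\<lambda>x. assemble (\<lambda>i. mul (c i) x)) ` F"
  proof
    fix g assume g: "g \<in> cell (assemble c)"
    have "\<exists>i<r. c i \<noteq> 0"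
    proof (rule ccontr)
      assume "\<not> (\<exists>i<r. c i \<noteq> 0)"
      then have "assemble c = 0" by (simp add: assemble_def)
      then show False using nz by simp
    qed
    then obtain i where i: "i < r" "c i \<noteq> 0" by auto
    obtain x where x: "x \<in> F" "mul (c i) x = coord i g"
      using mul_solve_right[of "c i" "coord i g"] i c by auto
    have "g = assemble (\<lambda>i. mul (c i) x)"
    proof (rule cell_inj[OF i(1) _ g])
      show "assemble (\<lambda>i. mul (c i) x) \<in> cell (assemble c)" using c x(1) by (rule assemble_mul_cell)
    qed (use i c x in simp_all)
    then show "g \<in> (\<lambda>x. assemble (\<lambda>i. mul (c i) x)) ` F" using x by blast
  qed
qed

end

subsection \<open>Distributivity and coordinates over the field\<close>

lemma (in normal_frame) S_nonzero:
  assumes U: "U \<in> S"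
  shows "\<exists>x\<in>U. x \<noteq> 0"
proof -
  have "1 < CARD('a)" using card_mono[of UNIV "{0, 1 :: 'a}"] by simp
  then have "1 < CARD('a) ^ n" using n by (intro one_less_power) auto
  then have "1 < card U" using card_S[OF U] by simp
  then have "\<not> U \<subseteq> {0}" using card_mono[of "{0}" U] by auto
  then show ?thesis by auto
qed

context normal_frame_unit
begin

text \<open>Normality of the extra element enters the algebra in this form: after \<open>h\<close>
  is shifted by a vector of \<open>G\<close>, the points of the new spread element still split along
  \<open>cell h\<close> and \<open>G\<close>.\<close>

lemma cell_add_normal:
  assumes G: "normal_element S G" "\<gamma> \<in> G" and g: "g \<in> cell (h + \<gamma>)"
  obtains u x where "u \<in> cell h" "x \<in> G" "g = u + x"
proof -
  have GS: "G \<in> S" using G by (simp add: normal_element_def)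
  have "closed (vec.span (G \<union> cell h))" by (rule closed_span_normal[OF G(1) cell_closed])
  moreover have "h + \<gamma> \<in> vec.span (G \<union> cell h)"
    using G(2) by (intro vec.span_add vec.span_base) auto
  ultimately have "g \<in> vec.span (G \<union> cell h)" using g closed_cell by blast
  then show ?thesis
    using that span_Un_subspace[OF S_subspace[OF GS] cell_subspace] add.commute by (smt (verit) mem_Collect_eq)
qed

text \<open>In the order \<open>k\<close>, \<open>i\<close>, \<open>l\<close>, the vector
  \<open>h\<close> is \<open>(e, a, 0)\<close> and \<delta> is \<open>(0, t, w t)\<close>. The point
  of \<open>cell (h + \<delta>)\<close> with first coordinate \<open>y\<close> is
  \<open>(y, (a + t) y, (w t) y)\<close>; it is also \<open>(y, a y, 0)\<close> plus a vector
  \<open>(0, s, w s)\<close> of \<open>G\<close>. Cancelling \<open>w\<close> in the last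
  coordinates gives \<open>s = t y\<close>, and the middle ones give the claim.\<close>

lemma mul_add_left_if_zero_coord:
  assumes G: "normal_element S G" "\<gamma> \<in> G" and ikl: "i < r" "k < r" "l < r" "i \<noteq> k" "k \<noteq> l" "i \<noteq> l"
    and \<gamma>: "coord i \<gamma> \<noteq> 0" "coord l \<gamma> \<noteq> 0" "coord k \<gamma> = 0"
    and F: "a \<in> F" "t \<in> F" "y \<in> F"
  shows "mul (a + t) y = mul a y + mul t y"
proof -
  have GS: "G \<in> S" using G by (simp add: normal_element_def)
  have "\<gamma> \<noteq> 0" using \<gamma>(1) ikl by auto
  then have cG: "cell \<gamma> = G" using S_cell GS G(2) by blast
  have Gk: "coord k x = 0" if "x \<in> G" for x
    using that coord_cell_0[of k x \<gamma>] ikl \<gamma>(3) cG by simp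
  obtain w where w: "w \<in> F" "\<And>x. x \<in> G \<Longrightarrow> coord l x = mul w (coord i x)"
    using mul_coherent[of i l \<gamma>] ikl \<gamma>(1) cG by metis
  have w0: "w \<noteq> 0" using w(2)[OF G(2)] \<gamma>(2) ikl by auto
  obtain \<delta> where \<delta>: "\<delta> \<in> G" "coord i \<delta> = t" using cell_point[of i \<gamma> t] ikl \<gamma> F cG by metis
  define h where "h = pair k i e a"
  have h: "coord k h = e" "coord i h = a" "coord l h = 0"
    using ikl F by (simp_all add: h_def coord_pair)
  have hd: "coord k (h + \<delta>) = e" "coord i (h + \<delta>) = a + t" "coord l (h + \<delta>) = mul w t"
    using h \<delta> Gk ikl w(2) by simp_all
  obtain g where g: "g \<in> cell (h + \<delta>)" "coord k g = y"
    using cell_point[of k "h + \<delta>" y] hd ikl e_nonzero F by metis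
  obtain u x where ux: "u \<in> cell h" "x \<in> G" "g = u + x" using cell_add_normal[OF G(1) \<delta>(1) g(1)] .
  have uk: "coord k u = y" using ux Gk[of x] g(2) ikl by simp
  have ui: "coord i u = mul a y" using mul_cell[of k i u h] ikl ux h uk by simp
  have ul: "coord l u = 0" using mul_cell[of k l u h] ikl ux h uk F by simp
  have gi: "mul (a + t) y = mul a y + coord i x"
    using mul_cell[of k i g "h + \<delta>"] ikl g hd ux ui by simp
  have "mul (mul w t) y = mul w (coord i x)"
    using mul_cell[of k l g "h + \<delta>"] ikl g hd ux ul w(2)[OF ux(2)] by simp
  then have "mul w (mul t y) = mul w (coord i x)" using mul_assoc w F by simp
  then have "mul t y = coord i x" using mul_inj_right[of w "mul t y" "coord i x"] w w0 F ikl by simp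
  then show ?thesis using gi by simp
qed

text \<open>
  The point \<open>h + e\<close> has coordinates \<open>(c, w * (c - e) + e, e)\<close> and lies in the span of \<open>F\<close> (the diagonal)
  and of the spread element through \<open>(c - e, w * (c - e), 0)\<close>; the claim compares the two descriptions
  of the spread element through it, with \<open>d = w * c\<close>.
\<close>

lemma mul_affine_if_F_normal:
  assumes G: "normal_element S F" and F: "w \<in> F" "d \<in> F" "z \<in> F" and w0: "w \<noteq> 0"
  shows "mul (e - w + d) z = z - mul w z + mul d z"
proof -
  have ikl: "0 < r" "1 < r" "2 < r" using r by auto
  obtain c where c: "c \<in> F" "mul w c = d" using mul_solve_right[of w d] F w0 by auto
  define t where "t = c - e"
  have t: "t \<in> F" using c by (simp add: t_def)
  define h where "h = pair 0 1 t (mul w t)"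
  have h: "coord 0 h = t" "coord 1 h = mul w t" "coord 2 h = 0"
    using ikl F t by (simp_all add: h_def coord_pair)
  have he: "coord 0 (h + e) = t + e" "coord 1 (h + e) = mul w t + e" "coord 2 (h + e) = e"
    using h ikl by simp_all
  obtain g where g: "g \<in> cell (h + e)" "coord 2 g = z"
    using cell_point[of 2 "h + e" z] he ikl e_nonzero F by metis
  obtain u x where ux: "u \<in> cell h" "x \<in> F" "g = u + x" using cell_add_normal[OF G e_F g(1)] .
  have u2: "coord 2 u = 0" using coord_cell_0[of 2 u h] ux h ikl by simp
  have x: "x = z" using g(2) ux u2 ikl by simp
  \<comment> \<open>The point \<open>h\<close> itself shows that its spread element has slope
    \<open>w\<close>; for \<open>t = 0\<close> the cell degenerates to \<open>{0}\<close>.\<close>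
  have u1: "coord 1 u = mul w (coord 0 u)"
  proof (cases "t = 0")
    case True
    then have "h = 0" using F ikl by (simp add: h_def pair_def)
    then show ?thesis using ux F ikl by simp
  next
    case False
    obtain v where v: "v \<in> F" "\<And>g. g \<in> cell h \<Longrightarrow> coord 1 g = mul v (coord 0 g)"
      using mul_coherent[of 0 1 h] ikl False h by auto
    have "mul w t = mul v t" using v(2)[of h] h by simp
    then have "w = v" using mul_inj_left[of w v t] v F t False by simp
    then show ?thesis using v ux by simp
  qed
  have u0: "coord 0 u = mul c z - z"
    using mul_cell[of 2 0 g "h + e"] ikl g he ux x by (simp add: t_def algebra_simps)
  have "mul (mul w t + e) z = coord 1 u + z"
    using mul_cell[of 2 1 g "h + e"] ikl g he ux x by simp
  also have "coord 1 u = mul w (mul c z) - mul w z" using u1 u0 F c by (simp add: mul_diff_right)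
  also have "mul w (mul c z) = mul d z" using mul_assoc[of w c z] c F by simp
  also have "mul w t = d - w" using c F by (simp add: t_def mul_diff_right)
  finally show ?thesis by (simp add: algebra_simps)
qed

text \<open>The affine law is a distributive law disturbed by a shift by \<open>e\<close>. Special
  choices of \<open>w\<close> and \<open>d\<close> show that multiplication is compatible with
  shifts by \<open>e + e\<close>, and odd order turns these into shifts by \<open>e\<close>.\<close>

lemma mul_add_left_if_F_normal:
  assumes G: "normal_element S F" and odd: "odd CARD('a)" and F: "a \<in> F" "b \<in> F" "z \<in> F"
  shows "mul (a + b) z = mul a z + mul b z"
proof -
  note aff = mul_affine_if_F_normal[OF G]
  \<comment> \<open>This represents one half in the prime field, so \<open>m\<close> shifts by
    \<open>e + e\<close> amount to one shift by \<open>e\<close>.\<close>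
  define m where "m = (CHAR('a) + 1) div 2"
  have "odd CHAR('a)" using odd CHAR_dvd_CARD[where 'a = 'a] by (metis dvd_trans)
  then have "2 * m = CHAR('a) + 1" by (simp add: m_def)
  then have m: "of_nat (2 * m) = (1 :: 'a)" by (simp only: of_nat_add of_nat_CHAR) simp
  have two: "e + e \<noteq> 0"
  proof
    assume "e + e = 0"
    then have "(1 + 1) *s e = 0" by (simp only: vec.scale_left_distrib) simp
    then have "(1 + 1 :: 'a) = 0" using e_nonzero by simp
    then have "of_nat 2 = (0 :: 'a)" by simp
    then have "CHAR('a) dvd 2" by (simp only: of_nat_eq_0_iff_char_dvd)
    then have "CHAR('a) = 1" using \<open>odd CHAR('a)\<close> by (metis dvd_refl one_dvd prime_nat_iff two_is_prime_nat)
    then show False using of_nat_CHAR[where 'a = 'a] by simp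
  qed
  \<comment> \<open>The values \<open>w = e + e\<close> and \<open>d = e\<close> make the left
    factor \<open>e - w + d\<close> zero.\<close>
  have twoz: "mul (e + e) y = y + y" if y: "y \<in> F" for y
  proof -
    have "e - (e + e) + e = 0" by simp
    then have "0 = y - mul (e + e) y + y"
      using aff[OF F_add[OF e_F e_F] e_F y two] y by (simp only:) (simp only: mul_0_left mul_e_left)
    moreover have "M = y + y" if "0 = y - M + y" for M
      using that by (simp add: algebra_simps)
    ultimately show ?thesis by blast
  qed
  \<comment> \<open>The same \<open>w\<close> with \<open>d = 0\<close> makes the left factor
    \<open>- e\<close>.\<close>
  have neg: "mul (- e) y = - y" if y: "y \<in> F" for y
  proof -
    have "e - (e + e) + 0 = - e" by simp
    then show ?thesis
      using aff[OF F_add[OF e_F e_F] zero_F y two] y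
      by (simp only: twoz mul_0_left) simp
  qed
  \<comment> \<open>Here \<open>w = - e\<close>, which turns the affine law into a shift by
    \<open>e + e\<close>.\<close>
  have add2: "mul (e + e + c) y = y + y + mul c y" if "c \<in> F" "y \<in> F" for c y
  proof -
    have "e - - e + c = e + e + c" by simp
    then show ?thesis using aff[of "- e" c y] neg that e_nonzero by simp
  qed
  have addk: "mul (of_nat (2 * k) *s e + c) y = of_nat (2 * k) *s y + mul c y" if "c \<in> F" "y \<in> F" for c y k
  proof (induction k)
    case (Suc k)
    have split: "of_nat (2 * Suc k) *s x = x + x + of_nat (2 * k) *s x" for x :: "'a ^ 'm"
    proof -
      have "of_nat (2 * Suc k) *s x = (1 + 1 + of_nat (2 * k)) *s x" by simp
      then show ?thesis by (simp only: vec.scale_left_distrib vec.scale_one)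
    qed
    show ?case
      using add2[of "of_nat (2 * k) *s e + c" y] Suc that by (simp only: split add.assoc) simp
  qed simp
  have add1: "mul (e + c) y = y + mul c y" if "c \<in> F" "y \<in> F" for c y
    using addk[OF that, of m] by (simp only: m vec.scale_one)
  \<comment> \<open>The left factor of the affine law is \<open>e + (d - w)\<close>; removing the
    shift by \<open>e\<close> leaves a law for differences.\<close>
  have diff: "mul (d - w) y = mul d y - mul w y" if "w \<in> F" "d \<in> F" "y \<in> F" for w d y
  proof (cases "w = 0")
    case False
    have "e - w + d = e + (d - w)" by simp
    then show ?thesis using aff[OF that False] add1[of "d - w" y] that by (simp add: algebra_simps)
  qed (use that in simp)
  show ?thesis using diff[of b "a + b" z] F by (simp add: algebra_simps)
qed

section \<open>Field reduction over the coordinate field\<close>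

definition mul_ring :: "('a ^ 'm) ring" where
  "mul_ring = \<lparr>carrier = F, monoid.mult = mul, one = e, zero = 0, add = (+)\<rparr>"

lemma mul_ring_simps [simp]:
  "carrier mul_ring = F" "monoid.mult mul_ring = mul" "one mul_ring = e" "zero mul_ring = 0"
  "add mul_ring = (+)"
  by (simp_all add: mul_ring_def)

lemma mul_ring_field:
  assumes add_left: "\<And>a b c. a \<in> F \<Longrightarrow> b \<in> F \<Longrightarrow> c \<in> F \<Longrightarrow> mul (a + b) c = mul a c + mul b c"
  shows "field mul_ring"
proof -
  have "ring mul_ring"
  proof (rule ringI)
    show "abelian_group mul_ring"
      by (rule abelian_groupI) (auto simp: add_ac intro: bexI[of _ "- _"])
    show "monoid mul_ring" by (rule monoidI) (auto simp: mul_assoc)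
  qed (auto simp: add_left mul_add_right)
  then interpret ring mul_ring .
  have "\<exists>b\<in>F. mul b a = e \<and> mul a b = e" if a: "a \<in> F" "a \<noteq> 0" for a
  proof -
    obtain b where b: "b \<in> F" "mul a b = e" using mul_solve_right[of a e] a by auto
    obtain c where c: "c \<in> F" "mul c a = e" using mul_solve_left[of a e] a by auto
    have "c = mul c (mul a b)" using b c by simp
    also have "\<dots> = b" using mul_assoc[of c a b] a b c by simp
    finally show ?thesis using b c by auto
  qed
  then have "Units mul_ring = carrier mul_ring - {\<zero>\<^bsub>mul_ring\<^esub>}"
    using e_nonzero by (auto simp: Units_def)
  then show ?thesis by (intro wedderburn) simp_all
qed

text \<open>Commutativity is used twice: it makes the multiples \<open>c *s e\<close> of the unit
  act as scalars from the left, and it turns the right multiples describing \<open>cell\<close> into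
  the left multiples of \<open>coord_smult\<close>.\<close>

lemma desarguesian_if_add_left:
  assumes add_left: "\<And>a b c. a \<in> F \<Longrightarrow> b \<in> F \<Longrightarrow> c \<in> F \<Longrightarrow> mul (a + b) c = mul a c + mul b c"
  shows "desarguesian_spread r n S"
proof -
  interpret M: field mul_ring by (rule mul_ring_field[OF add_left])
  have comm: "mul a b = mul b a" if "a \<in> F" "b \<in> F" for a b
    using M.m_comm[of a b] that by simp
  have mul_scalar: "mul (c *s e) x = c *s x" if "x \<in> F" for c x
    using comm[of "c *s e" x] that by (simp add: mul_scale_right)
  \<comment> \<open>A Desarguesian spread is defined with a carrier inside \<open>nat\<close>, so
    the field on \<open>F\<close> is transported along an injection.\<close>
  obtain \<psi> :: "'a ^ 'm \<Rightarrow> nat" where \<psi>: "inj \<psi>"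
    using finite_imp_inj_to_nat_seg[of "UNIV :: ('a ^ 'm) set"] by auto
  define K where "K = image_ring \<psi> mul_ring"
  have \<psi>F: "inj_on \<psi> (carrier mul_ring)" using \<psi> by (rule inj_on_subset) simp
  have K: "field K" unfolding K_def by (rule M.inj_imp_image_ring_is_field[OF \<psi>F])
  have hom: "\<psi> \<in> ring_hom mul_ring K"
    using inj_imp_image_ring_iso[OF \<psi>F] by (simp add: K_def ring_iso_def)
  have Kc: "carrier K = \<psi> ` F" by (simp add: K_def image_ring_carrier)
  have Kmul: "\<psi> x \<otimes>\<^bsub>K\<^esub> \<psi> y = \<psi> (mul x y)" if "x \<in> F" "y \<in> F" for x y
    using ring_hom_mult[OF hom, of x y] that by simp
  have Kadd: "\<psi> x \<oplus>\<^bsub>K\<^esub> \<psi> y = \<psi> (x + y)" if "x \<in> F" "y \<in> F" for x y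
    using ring_hom_add[OF hom, of x y] that by simp
  have Kone: "\<one>\<^bsub>K\<^esub> = \<psi> e" and Kzero: "\<zero>\<^bsub>K\<^esub> = \<psi> 0"
    by (simp_all add: K_def image_ring_one image_ring_zero)
  have card: "card (carrier K) = CARD('a) ^ n"
    using \<psi>F by (simp add: Kc card_image card_S F_S)
  \<comment> \<open>The field \<open>'a\<close> sits in \<open>F\<close> as the scalar multiples of
    the unit.\<close>
  define \<phi> where "\<phi> c = \<psi> (c *s e)" for c
  have \<phi>: "\<phi> \<in> ring_hom (ring_of_type_algebra :: 'a ring) K"
    by (rule ring_hom_memI)
       (auto simp: ring_of_type_algebra_def \<phi>_def Kc Kmul Kadd Kone mul_scalar vec.scale_left_distrib)
  define d where "d = inv_into UNIV \<psi>"
  have d [simp]: "d (\<psi> x) = x" for x using \<psi> by (simp add: d_def)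
  have dK: "d a \<in> F" "\<psi> (d a) = a" if "a \<in> carrier K" for a using that by (auto simp: Kc)
  define f where "f u = assemble (\<lambda>i. d (u i))" for u
  have space: "u i \<in> carrier K" if "u \<in> coord_space K r" "i < r" for u i
    using that by (auto simp: coord_space_def)
  have spaceF: "d (u i) \<in> F" if "u \<in> coord_space K r" "i < r" for u i
    using dK space that by blast
  have coord_f: "coord i (f u) = d (u i)" if "u \<in> coord_space K r" "i < r" for u i
    using that spaceF by (simp add: f_def)
  have bij: "bij_betw f (coord_space K r) UNIV"
  proof (rule bij_betw_byWitness[where f' = "\<lambda>v. \<lambda>i\<in>{..<r}. \<psi> (coord i v)"])
    show "\<forall>u\<in>coord_space K r. (\<lambda>i\<in>{..<r}. \<psi> (coord i (f u))) = u"
    proof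
      fix u assume u: "u \<in> coord_space K r"
      show "(\<lambda>i\<in>{..<r}. \<psi> (coord i (f u))) = u"
      proof (rule ext)
        fix i show "(\<lambda>i\<in>{..<r}. \<psi> (coord i (f u))) i = u i"
        proof (cases "i < r")
          case True
          then show ?thesis using coord_f[OF u True] dK(2)[OF space[OF u True]] by simp
        next
          case False
          then show ?thesis using PiE_arb[of u "{..<r}" "\<lambda>_. carrier K" i] u by (simp add: coord_space_def)
        qed
      qed
    qed
    show "\<forall>v\<in>UNIV. f (\<lambda>i\<in>{..<r}. \<psi> (coord i v)) = v"
    proof
      fix v
      have "f (\<lambda>i\<in>{..<r}. \<psi> (coord i v)) = assemble (\<lambda>i. coord i v)"
        by (simp add: f_def assemble_def)
      then show "f (\<lambda>i\<in>{..<r}. \<psi> (coord i v)) = v" by (simp add: assemble_coord)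
    qed
    show "(\<lambda>v. \<lambda>i\<in>{..<r}. \<psi> (coord i v)) ` UNIV \<subseteq> coord_space K r"
      unfolding coord_space_def by (intro image_subsetI) (simp only: restrict_PiE_iff, simp add: Kc)
  qed simp
  have smult_space: "coord_smult K r a u \<in> coord_space K r" if "a \<in> carrier K" "u \<in> coord_space K r" for a u
    using that space[OF that(2)] K by (auto simp: coord_smult_def coord_space_def intro!: monoid.m_closed ring.is_monoid field.is_ring)
  have add_space: "coord_add K r u v \<in> coord_space K r" if "u \<in> coord_space K r" "v \<in> coord_space K r" for u v
    using space[OF that(1)] space[OF that(2)] K
    by (auto simp: coord_add_def coord_space_def intro!: abelian_monoid.a_closed abelian_group.axioms ring.is_abelian_group field.is_ring)
  have f_add: "f (coord_add K r u v) = f u + f v" if u: "u \<in> coord_space K r" and v: "v \<in> coord_space K r" for u v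
  proof (rule coord_ext)
    fix i assume i: "i < r"
    have "coord_add K r u v i = \<psi> (d (u i) + d (v i))"
      using i spaceF[OF u i] spaceF[OF v i] dK(2)[OF space[OF u i]] dK(2)[OF space[OF v i]]
      by (simp add: coord_add_def flip: Kadd)
    then show "coord i (f (coord_add K r u v)) = coord i (f u + f v)"
      using i u v coord_f add_space by simp
  qed
  have smult_i: "d (coord_smult K r a u i) = mul (d a) (d (u i))"
    if u: "u \<in> coord_space K r" and a: "a \<in> carrier K" and i: "i < r" for u a i
  proof -
    have "coord_smult K r a u i = \<psi> (mul (d a) (d (u i)))"
      using i spaceF[OF u i] dK(1)[OF a] dK(2)[OF a] dK(2)[OF space[OF u i]]
      by (simp add: coord_smult_def flip: Kmul)
    then show ?thesis by simp
  qed
  have \<phi>K: "\<phi> c \<in> carrier K" for c by (simp add: \<phi>_def Kc)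
  have f_smult: "f (coord_smult K r (\<phi> c) v) = c *s f v" if v: "v \<in> coord_space K r" for c v
  proof (rule coord_ext)
    fix i assume i: "i < r"
    have "coord i (f (coord_smult K r (\<phi> c) v)) = mul (c *s e) (d (v i))"
      using coord_f[OF smult_space[OF \<phi>K v] i] smult_i[OF v \<phi>K i] by (simp add: \<phi>_def)
    then show "coord i (f (coord_smult K r (\<phi> c) v)) = coord i (c *s f v)"
      using i coord_f[OF v i] spaceF[OF v i] by (simp add: mul_scalar)
  qed
  have zero_space: "coord_zero K r \<in> coord_space K r"
    by (auto simp: coord_zero_def coord_space_def Kzero Kc)
  have f_zero: "f (coord_zero K r) = 0"
    by (simp add: f_def coord_zero_def Kzero assemble_def)
  have f_nonzero: "f v \<noteq> 0" if "v \<in> coord_space K r - {coord_zero K r}" for v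
    using that bij zero_space f_zero by (metis DiffD1 DiffD2 bij_betw_imp_inj_on inj_onD singletonI)
  have f_line: "f ` {coord_smult K r a v | a. a \<in> carrier K} = cell (f v)"
    if v: "v \<in> coord_space K r - {coord_zero K r}" for v
  proof -
    have v': "v \<in> coord_space K r" using v by simp
    have fa: "f (coord_smult K r a v) = assemble (\<lambda>i. mul (d (v i)) (d a))" if a: "a \<in> carrier K" for a
    proof (rule coord_ext)
      fix i assume i: "i < r"
      show "coord i (f (coord_smult K r a v)) = coord i (assemble (\<lambda>i. mul (d (v i)) (d a)))"
        using i coord_f[OF smult_space[OF a v'] i] smult_i[OF v' a i] spaceF[OF v'] dK(1)[OF a]
        by (simp add: comm)
    qed
    have "f ` {coord_smult K r a v | a. a \<in> carrier K} = (\<lambda>a. f (coord_smult K r a v)) ` carrier K"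
      by (simp add: image_image Setcompr_eq_image)
    also have "\<dots> = (\<lambda>a. assemble (\<lambda>i. mul (d (v i)) (d a))) ` carrier K"
      using fa by (intro image_cong) auto
    also have "\<dots> = (\<lambda>x. assemble (\<lambda>i. mul (d (v i)) x)) ` F"
      by (simp add: Kc image_image)
    also have "\<dots> = cell (f v)"
      using cell_assemble[of "\<lambda>i. d (v i)"] spaceF[OF v'] f_nonzero[OF v] by (simp add: f_def)
    finally show ?thesis .
  qed
  have "(\<lambda>L. f ` L) ` coord_lines K r = (\<lambda>v. cell (f v)) ` (coord_space K r - {coord_zero K r})"
    unfolding coord_lines_def Setcompr_eq_image[of "\<lambda>v. {coord_smult K r c v | c. c \<in> carrier K}"] image_image
    by (rule image_cong[OF refl f_line])
  also have "\<dots> = cell ` (f ` (coord_space K r - {coord_zero K r}))" by (simp add: image_image)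
  also have "f ` (coord_space K r - {coord_zero K r}) = UNIV - {0}"
    using bij zero_space f_zero by (auto simp: bij_betw_def inj_on_image_set_diff[of f "coord_space K r"])
  also have "cell ` (UNIV - {0}) = S"
  proof
    show "cell ` (UNIV - {0}) \<subseteq> S" using cell_S by auto
    show "S \<subseteq> cell ` (UNIV - {0})"
    proof
      fix U assume U: "U \<in> S"
      obtain x where "x \<in> U" "x \<noteq> 0" using S_nonzero[OF U] by blast
      then show "U \<in> cell ` (UNIV - {0})" using S_cell[OF U] by (intro image_eqI[of _ _ x]) auto
    qed
  qed
  finally show ?thesis
    unfolding desarguesian_spread_def using K card \<phi> bij f_add f_smult by blast
qed

end

text \<open>If a nonzero vector of \<open>G\<close> has all components nonzero, it serves as unit
  and \<open>G\<close> becomes the diagonal; this case uses odd order. Otherwise some component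
  vanishes while at least two do not, since a single nonzero component would force
  \<open>G = E i\<close>; then any unit will do.\<close>

lemma (in normal_frame) desarguesian_if_extra_normal:
  assumes odd: "odd CARD('a)" and G: "normal_element S G" and neq: "\<And>i. i < r \<Longrightarrow> E i \<noteq> G"
  shows "desarguesian_spread r n S"
proof -
  have GS: "G \<in> S" using G by (simp add: normal_element_def)
  obtain \<gamma> where \<gamma>: "\<gamma> \<in> G" "\<gamma> \<noteq> 0" using S_nonzero[OF GS] by blast
  have cG: "cell \<gamma> = G" using S_cell GS \<gamma> by blast
  show ?thesis
  proof (cases "\<forall>i<r. proj i \<gamma> \<noteq> 0")
    case True
    then interpret normal_frame_unit S n r E \<gamma> by unfold_locales auto
    have "F = G" by (simp add: F_def cG)
    then show ?thesis using desarguesian_if_add_left mul_add_left_if_F_normal G odd by blast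
  next
    case False
    then obtain k where k: "k < r" "proj k \<gamma> = 0" by auto
    have "\<exists>i<r. proj i \<gamma> \<noteq> 0"
    proof (rule ccontr)
      assume "\<not> (\<exists>i<r. proj i \<gamma> \<noteq> 0)"
      then have "(\<Sum>i<r. proj i \<gamma>) = 0" by simp
      then show False using \<gamma>(2) sum_proj[of \<gamma>] by simp
    qed
    then obtain i where i: "i < r" "proj i \<gamma> \<noteq> 0" by auto
    have "\<exists>l<r. l \<noteq> i \<and> proj l \<gamma> \<noteq> 0"
    proof (rule ccontr)
      assume *: "\<not> (\<exists>l<r. l \<noteq> i \<and> proj l \<gamma> \<noteq> 0)"
      have "\<gamma> = proj i \<gamma>"
        by (rule vec_eqI) (use * i in \<open>auto simp: proj_E[OF _ _ proj_in]\<close>)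
      then have "\<gamma> \<in> E i" using proj_in[OF i(1)] by metis
      then have "E i = G" using S_cell[OF E_S[OF i(1)]] \<gamma>(2) cG by simp
      then show False using neq i by simp
    qed
    then obtain l where l: "l < r" "l \<noteq> i" "proj l \<gamma> \<noteq> 0" by auto
    have "\<forall>i. \<exists>x. i < r \<longrightarrow> x \<in> E i \<and> x \<noteq> 0" using S_nonzero[OF E_S] by blast
    then obtain b where b: "\<And>i. i < r \<Longrightarrow> b i \<in> E i \<and> b i \<noteq> 0" by metis
    have pb: "proj i (\<Sum>i<r. b i) = b i" if "i < r" for i
      using b that by (intro proj_unique) auto
    interpret normal_frame_unit S n r E "\<Sum>i<r. b i"
      by unfold_locales (use b pb in auto)
    show ?thesis
    proof (rule desarguesian_if_add_left)
      fix a t y assume "a \<in> F" "t \<in> F" "y \<in> F"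
      moreover have "i \<noteq> k" "k \<noteq> l" using i k l by auto
      ultimately show "mul (a + t) y = mul a y + mul t y"
        using mul_add_left_if_zero_coord[OF G \<gamma>(1) i(1) k(1) l(1)] i k l
        by (simp add: coord_eq_0_iff)
    qed
  qed
qed

theorem theorem5p11:
  fixes S :: "('a::{field,finite} ^ 'm::finite) set set"
    and q r n :: nat
  assumes "CARD('a) = q" and "odd q"
    and "r > 2" and "n \<ge> 1"
    and "CARD('m) = r * n"
    and "pg_spread (n - 1) S"
    and "\<exists>A B. B \<subseteq> A \<and> A \<subseteq> {E. normal_element S E} \<and> card A \<ge> r + 1 \<and>
           card B = r \<and> vec.span (\<Union>B) = UNIV"
  shows "desarguesian_spread r n S"
proof -
  obtain A B where AB: "B \<subseteq> A" "A \<subseteq> {E. normal_element S E}" "card A \<ge> r + 1"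
    "card B = r" "vec.span (\<Union>B) = UNIV"
    using assms by blast
  have "finite B" by simp
  then obtain E where "bij_betw E {0..<card B} B" using ex_bij_betw_nat_finite by blast
  then have E: "E ` {..<r} = B" using AB(4) by (simp add: bij_betw_def atLeast0LessThan)
  \<comment> \<open>The set \<open>A\<close> has more elements than \<open>B\<close>, which supplies
    a normal element outside the frame.\<close>
  have "A \<noteq> B" using AB by auto
  then obtain G where G: "G \<in> A" "G \<notin> B" using AB(1) by auto
  interpret normal_frame S n r E
  proof
    show "normal_element S (E i)" if "i < r" for i using that E AB by blast
    show "vec.span (\<Union>i<r. E i) = UNIV" using AB(5) E by simp
  qed (use assms in auto)
  show ?thesis
    using desarguesian_if_extra_normal[of G] assms(1,2) G AB(2) E by blast
qed

end
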